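(* Let $\alpha>0$, let $\mathcal T$ be a compact real tree (coded by a height function $\zeta$, with root $\emptyset$, mass measure $m^{\mathcal T}$ and length measure $\ell$), let $M$ be the mark process on $\mathcal T$ with law $\mathbb M_\infty^{\mathcal T}$, and let $\Theta=\int_{\mathcal T}\theta(x)\,m^{\mathcal T}(dx)$. For every positive integer $r$, $$\mathbb M_\infty^{\mathcal T}[\Theta^r]=\frac{r!}{(2\alpha)^r}\int_{\mathcal T^r}\frac{m^{\mathcal T}(dx_1)\cdots m^{\mathcal T}(dx_r)}{\prod_{i=1}^r\ell(\mathcal T(x_1,\ldots,x_i))},$$ where $\mathcal T(x_1,\ldots,x_i)=\bigcup_{j=1}^i[\![\emptyset,x_j]\!]$ is the subtree spanned by the root and $x_1,\ldots,x_i$.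
   Context: Coded trees: let $\zeta:[0,\infty)\to[0,\infty)$ be continuous with compact support $[0,\sigma]$ and $\zeta(0)=\zeta(\sigma)=0$. Put $m_\zeta(s,t)=\inf_{u\in[s\wedge t,s\vee t]}\zeta(u)$, $d(s,t)=\zeta(s)+\zeta(t)-2m_\zeta(s,t)$, and $s\sim t$ iff $d(s,t)=0$. The quotient $\mathcal T=[0,\infty)/\!\sim$ with the induced metric $d$ is a compact real tree; $p$ is the canonical projection and the root is $\emptyset=p(0)$. For $x,y\in\mathcal T$, $[\![x,y]\!]$ denotes the geodesic between $x$ and $y$. The mass measure $m^{\mathcal T}$ is the push-forward by $p$ of Lebesgue measure on $[0,\sigma]$. The length measure $\ell$ is the measure carried by the skeleton (the complement of the set of leaves, a leaf being a point whose removal leaves $\mathcal T$ connected) such that $\ell([\![x,y]\!])=d(x,y)$. Mark process: given $\mathcal T$, under $\mathbb M_\infty^{\mathcal T}$, $M(dx,dq)$ is a Poisson point measure on $\mathcal T\times[0,\infty)$ with intensity $2\alpha\,\ell(dx)\,dq$; $\mathbb M_\infty^{\mathcal T}[\cdot]$ also denotes expectation. For $x\in\mathcal T$, $\theta(x)=\inf\{q>0:\ M([\![\emptyset,x]\!]\times[0,q])>0\}$ (with $\inf\varnothing=+\infty$). Convention: $1/0=+\infty$. *)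

theory Defs
  imports "HOL-Probability.Probability"
begin

section \<open>Trees coded by a height function\<close>

text \<open>A height function is given as a real function of which only the values on
  \<open>[0, \<infinity>)\<close> matter. Its support is taken literally, as a closure.\<close>

definition height_function :: "(real \<Rightarrow> real) \<Rightarrow> real \<Rightarrow> bool" where
  "height_function \<zeta> \<sigma> \<longleftrightarrow>
     continuous_on {0..} \<zeta> \<and> (\<forall>s\<ge>0. 0 \<le> \<zeta> s) \<and> 0 \<le> \<sigma> \<and>
     closure {s \<in> {0..}. \<zeta> s \<noteq> 0} = {0..\<sigma>} \<and> \<zeta> 0 = 0 \<and> \<zeta> \<sigma> = 0"

definition height_min :: "(real \<Rightarrow> real) \<Rightarrow> real \<Rightarrow> real \<Rightarrow> real" where
  "height_min \<zeta> s t = (INF u\<in>{min s t..max s t}. \<zeta> u)"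

definition height_dist :: "(real \<Rightarrow> real) \<Rightarrow> real \<Rightarrow> real \<Rightarrow> real" where
  "height_dist \<zeta> s t = \<zeta> s + \<zeta> t - 2 * height_min \<zeta> s t"

definition height_rel :: "(real \<Rightarrow> real) \<Rightarrow> (real \<times> real) set" where
  "height_rel \<zeta> = {(s, t). 0 \<le> s \<and> 0 \<le> t \<and> height_dist \<zeta> s t = 0}"

definition tree :: "(real \<Rightarrow> real) \<Rightarrow> real set set" where
  "tree \<zeta> = {0..} // height_rel \<zeta>"

definition tree_proj :: "(real \<Rightarrow> real) \<Rightarrow> real \<Rightarrow> real set" where
  "tree_proj \<zeta> s = height_rel \<zeta> `` {s}"

definition tree_root :: "(real \<Rightarrow> real) \<Rightarrow> real set" where
  "tree_root \<zeta> = tree_proj \<zeta> 0"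

text \<open>The value 0 outside the tree is only there because \<open>Metric_space\<close> wants the distance
  to be nonnegative and symmetric on the whole type.\<close>

definition tree_dist :: "(real \<Rightarrow> real) \<Rightarrow> real set \<Rightarrow> real set \<Rightarrow> real" where
  "tree_dist \<zeta> x y =
     (if x \<in> tree \<zeta> \<and> y \<in> tree \<zeta> then the_elem (\<Union>s\<in>x. \<Union>t\<in>y. {height_dist \<zeta> s t}) else 0)"

definition tree_topology :: "(real \<Rightarrow> real) \<Rightarrow> real set topology" where
  "tree_topology \<zeta> = Metric_space.mtopology (tree \<zeta>) (tree_dist \<zeta>)"

definition tree_borel :: "(real \<Rightarrow> real) \<Rightarrow> real set measure" where
  "tree_borel \<zeta> = sigma (tree \<zeta>) {U. openin (tree_topology \<zeta>) U}"

text \<open>The geodesic is the range of the isometric path from \<open>x\<close> to \<open>y\<close>, which is unique in a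
  real tree.\<close>

definition isometric_path ::
    "(real \<Rightarrow> real) \<Rightarrow> real set \<Rightarrow> real set \<Rightarrow> (real \<Rightarrow> real set) \<Rightarrow> bool" where
  "isometric_path \<zeta> x y f \<longleftrightarrow>
     f \<in> {0..tree_dist \<zeta> x y} \<rightarrow> tree \<zeta> \<and>
     (\<forall>a\<in>{0..tree_dist \<zeta> x y}. \<forall>b\<in>{0..tree_dist \<zeta> x y}. tree_dist \<zeta> (f a) (f b) = \<bar>a - b\<bar>) \<and>
     f 0 = x \<and> f (tree_dist \<zeta> x y) = y"

definition geodesic :: "(real \<Rightarrow> real) \<Rightarrow> real set \<Rightarrow> real set \<Rightarrow> real set set" where
  "geodesic \<zeta> x y = (\<Union>f\<in>{f. isometric_path \<zeta> x y f}. f ` {0..tree_dist \<zeta> x y})"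

definition tree_leaves :: "(real \<Rightarrow> real) \<Rightarrow> real set set" where
  "tree_leaves \<zeta> = {x \<in> tree \<zeta>. connectedin (tree_topology \<zeta>) (tree \<zeta> - {x})}"

definition tree_skeleton :: "(real \<Rightarrow> real) \<Rightarrow> real set set" where
  "tree_skeleton \<zeta> = tree \<zeta> - tree_leaves \<zeta>"

definition mass_measure :: "(real \<Rightarrow> real) \<Rightarrow> real \<Rightarrow> real set measure" where
  "mass_measure \<zeta> \<sigma> = distr (restrict_space lborel {0..\<sigma>}) (tree_borel \<zeta>) (tree_proj \<zeta>)"

definition length_measure :: "(real \<Rightarrow> real) \<Rightarrow> real set measure \<Rightarrow> bool" where
  "length_measure \<zeta> L \<longleftrightarrow>
     sets L = sets (tree_borel \<zeta>) \<and>
     (AE x in L. x \<in> tree_skeleton \<zeta>) \<and>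
     (\<forall>x\<in>tree \<zeta>. \<forall>y\<in>tree \<zeta>. emeasure L (geodesic \<zeta> x y) = ennreal (tree_dist \<zeta> x y))"

definition spanned_subtree ::
    "(real \<Rightarrow> real) \<Rightarrow> (nat \<Rightarrow> real set) \<Rightarrow> nat \<Rightarrow> real set set" where
  "spanned_subtree \<zeta> x i = (\<Union>j\<in>{1..i}. geodesic \<zeta> (tree_root \<zeta>) (x j))"


section \<open>Poisson point measures\<close>

text \<open>\<open>N\<close> is a countable sum of unit point masses; the index set \<open>I\<close> may be finite, and points
  may be repeated.\<close>

definition point_measure_on :: "'a measure \<Rightarrow> 'a measure \<Rightarrow> bool" where
  "point_measure_on S N \<longleftrightarrow>
     (\<exists>(I :: nat set) a. a \<in> I \<rightarrow> space S \<and> N = distr (count_space I) S a)"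

text \<open>The library's \<open>poisson_pmf\<close> is only meaningful for a strictly positive finite rate; the
  degenerate laws of rate 0 and \<open>\<infinity>\<close> are the point masses there.\<close>

definition has_poisson_law :: "'w measure \<Rightarrow> ('w \<Rightarrow> ennreal) \<Rightarrow> ennreal \<Rightarrow> bool" where
  "has_poisson_law P X c \<longleftrightarrow>
     X \<in> borel_measurable P \<and>
     (if c = 0 \<or> c = \<infinity> then AE \<omega> in P. X \<omega> = c
      else distr P borel X = distr (measure_pmf (poisson_pmf (enn2real c))) borel of_nat)"

definition poisson_point_measure ::
    "'w measure \<Rightarrow> ('w \<Rightarrow> 'a measure) \<Rightarrow> 'a measure \<Rightarrow> bool" where
  "poisson_point_measure P M \<mu> \<longleftrightarrow>
     prob_space P \<and>
     (\<forall>\<omega>\<in>space P. point_measure_on \<mu> (M \<omega>)) \<and>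
     (\<forall>A\<in>sets \<mu>. has_poisson_law P (\<lambda>\<omega>. emeasure (M \<omega>) A) (emeasure \<mu> A)) \<and>
     (\<forall>(n::nat) A. disjoint_family_on A {..<n} \<longrightarrow> A ` {..<n} \<subseteq> sets \<mu> \<longrightarrow>
        prob_space.indep_vars P (\<lambda>_. borel) (\<lambda>i \<omega>. emeasure (M \<omega>) (A i)) {..<n})"


section \<open>The mark process\<close>

definition mark_process ::
    "real set measure \<Rightarrow> real \<Rightarrow>
     'w measure \<Rightarrow> ('w \<Rightarrow> (real set \<times> real) measure) \<Rightarrow> bool" where
  "mark_process L \<alpha> P M \<longleftrightarrow>
     poisson_point_measure P M
       (scale_measure (ennreal (2 * \<alpha>)) (L \<Otimes>\<^sub>M restrict_space lborel {0..}))"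

text \<open>An infimum in \<open>ennreal\<close>, so that the infimum of the empty set is \<open>\<infinity>\<close>.\<close>

definition mark_time ::
    "(real \<Rightarrow> real) \<Rightarrow> (real set \<times> real) measure \<Rightarrow> real set \<Rightarrow> ennreal" where
  "mark_time \<zeta> N x =
     Inf (ennreal ` {q. 0 < q \<and> 0 < emeasure N (geodesic \<zeta> (tree_root \<zeta>) x \<times> {0..q})})"

definition total_mark_time ::
    "(real \<Rightarrow> real) \<Rightarrow> real \<Rightarrow> (real set \<times> real) measure \<Rightarrow> ennreal" where
  "total_mark_time \<zeta> \<sigma> N = (\<integral>\<^sup>+ x. mark_time \<zeta> N x \<partial>mass_measure \<zeta> \<sigma>)"


section \<open>Well-posedness\<close>

context
  fixes \<zeta> :: "real \<Rightarrow> real"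
  assumes nonneg: "\<And>s. 0 \<le> s \<Longrightarrow> 0 \<le> \<zeta> s"
begin

lemma height_min_le:
  assumes "0 \<le> s" "0 \<le> t" "u \<in> {min s t..max s t}"
  shows "height_min \<zeta> s t \<le> \<zeta> u"
  unfolding height_min_def
proof (rule cINF_lower)
  show "bdd_below (\<zeta> ` {min s t..max s t})"
  proof (rule bdd_belowI2)
    fix v assume "v \<in> {min s t..max s t}"
    then show "0 \<le> \<zeta> v" using assms(1,2) by (intro nonneg) (auto simp: min_le_iff_disj)
  qed
qed (rule assms(3))

lemma height_min_greatest:
  assumes "\<And>u. u \<in> {min s t..max s t} \<Longrightarrow> c \<le> \<zeta> u"
  shows "c \<le> height_min \<zeta> s t"
  unfolding height_min_def by (rule cINF_greatest) (simp, rule assms)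

lemma height_dist_nonneg: "0 \<le> s \<Longrightarrow> 0 \<le> t \<Longrightarrow> 0 \<le> height_dist \<zeta> s t"
  using height_min_le[of s t s] height_min_le[of s t t] by (simp add: height_dist_def)

lemma height_dist_sym: "height_dist \<zeta> s t = height_dist \<zeta> t s"
  by (simp add: height_dist_def height_min_def min.commute max.commute)

lemma height_dist_refl: "height_dist \<zeta> s s = 0"
  by (simp add: height_dist_def height_min_def)

lemma height_dist_triangle:
  assumes "0 \<le> s" "0 \<le> t" "0 \<le> u"
  shows "height_dist \<zeta> s u \<le> height_dist \<zeta> s t + height_dist \<zeta> t u"
proof -
  have "min (height_min \<zeta> s t) (height_min \<zeta> t u) \<le> height_min \<zeta> s u"
  proof (rule height_min_greatest)
    fix v assume "v \<in> {min s u..max s u}"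
    then have "v \<in> {min s t..max s t} \<or> v \<in> {min t u..max t u}"
      by (auto simp: min_def max_def split: if_splits)
    then show "min (height_min \<zeta> s t) (height_min \<zeta> t u) \<le> \<zeta> v"
      using height_min_le[of s t v] height_min_le[of t u v] assms by (auto simp: min_le_iff_disj)
  qed
  moreover have "height_min \<zeta> s t \<le> \<zeta> t" "height_min \<zeta> t u \<le> \<zeta> t"
    using height_min_le[of s t t] height_min_le[of t u t] assms by auto
  ultimately show ?thesis
    by (auto simp: height_dist_def min_def split: if_splits)
qed

lemma equiv_height_rel: "equiv {0..} (height_rel \<zeta>)"
proof (rule equivI)
  show "trans (height_rel \<zeta>)"
  proof (rule transI)
    fix s t u assume "(s, t) \<in> height_rel \<zeta>" "(t, u) \<in> height_rel \<zeta>"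
    then show "(s, u) \<in> height_rel \<zeta>"
      using height_dist_triangle[of s t u] height_dist_nonneg[of s u]
      by (auto simp: height_rel_def)
  qed
  show "sym (height_rel \<zeta>)"
    by (rule symI) (simp add: height_rel_def, metis height_dist_sym)
  show "refl_on {0..} (height_rel \<zeta>)"
    by (rule refl_onI) (simp add: height_rel_def height_dist_refl)
  show "height_rel \<zeta> \<subseteq> {0..} \<times> {0..}"
    by (auto simp: height_rel_def)
qed

lemma tree_proj_mem: "0 \<le> s \<Longrightarrow> tree_proj \<zeta> s \<in> tree \<zeta>"
  by (auto simp: tree_proj_def tree_def intro: quotientI)

lemma tree_cases:
  assumes "x \<in> tree \<zeta>" obtains s where "0 \<le> s" "x = tree_proj \<zeta> s"
proof -
  from assms obtain s where "s \<in> {0..}" "x = height_rel \<zeta> `` {s}"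
    unfolding tree_def by (rule quotientE)
  then show ?thesis using that[of s] by (simp add: tree_proj_def)
qed

lemma tree_dist_proj:
  assumes s: "0 \<le> s" and t: "0 \<le> t"
  shows "tree_dist \<zeta> (tree_proj \<zeta> s) (tree_proj \<zeta> t) = height_dist \<zeta> s t"
proof -
  have "height_dist \<zeta> s' t' = height_dist \<zeta> s t"
    if "s' \<in> tree_proj \<zeta> s" "t' \<in> tree_proj \<zeta> t" for s' t'
  proof -
    have *: "0 \<le> s'" "0 \<le> t'" "height_dist \<zeta> s s' = 0" "height_dist \<zeta> t t' = 0"
      using that by (auto simp: tree_proj_def height_rel_def)
    then show ?thesis
      using s t height_dist_triangle[of s s' t] height_dist_triangle[of s' t' t]
        height_dist_triangle[of s' s t'] height_dist_triangle[of s t t']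
        height_dist_sym[of s s'] height_dist_sym[of t t'] by linarith
  qed
  moreover have "s \<in> tree_proj \<zeta> s" "t \<in> tree_proj \<zeta> t"
    using s t by (auto simp: tree_proj_def height_rel_def height_dist_refl)
  ultimately have "(\<Union>a\<in>tree_proj \<zeta> s. \<Union>b\<in>tree_proj \<zeta> t. {height_dist \<zeta> a b}) = {height_dist \<zeta> s t}"
    by blast
  then show ?thesis
    using s t by (simp add: tree_dist_def tree_proj_mem)
qed

lemma Metric_space_tree: "Metric_space (tree \<zeta>) (tree_dist \<zeta>)"
proof
  have out: "tree_dist \<zeta> x y = 0" if "x \<notin> tree \<zeta> \<or> y \<notin> tree \<zeta>" for x y
    using that by (auto simp: tree_dist_def)
  show "0 \<le> tree_dist \<zeta> x y" for x y
    using out[of x y] by (cases "x \<in> tree \<zeta> \<and> y \<in> tree \<zeta>")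
      (auto simp: tree_dist_proj height_dist_nonneg elim!: tree_cases)
  show "tree_dist \<zeta> x y = tree_dist \<zeta> y x" for x y
    using out[of x y] out[of y x] by (cases "x \<in> tree \<zeta> \<and> y \<in> tree \<zeta>")
      (auto simp: tree_dist_proj height_dist_sym elim!: tree_cases)
  fix x y assume "x \<in> tree \<zeta>" "y \<in> tree \<zeta>"
  then obtain s t where st: "0 \<le> s" "x = tree_proj \<zeta> s" "0 \<le> t" "y = tree_proj \<zeta> t"
    by (elim tree_cases)
  have "x = y \<longleftrightarrow> (s, t) \<in> height_rel \<zeta>"
    using st equiv_class_eq_iff[OF equiv_height_rel, of s t] by (auto simp: tree_proj_def)
  then show "tree_dist \<zeta> x y = 0 \<longleftrightarrow> x = y"
    using st by (simp add: tree_dist_proj height_rel_def)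
  fix z assume "z \<in> tree \<zeta>"
  then show "tree_dist \<zeta> x z \<le> tree_dist \<zeta> x y + tree_dist \<zeta> y z"
    using st by (auto simp: tree_dist_proj height_dist_triangle elim!: tree_cases)
qed

text \<open>The projection is measurable, so \<open>mass_measure\<close> is a genuine push-forward.\<close>

lemma tree_proj_measurable:
  assumes cont: "continuous_on {0..} \<zeta>"
  shows "tree_proj \<zeta> \<in> restrict_space lborel {0..\<sigma>} \<rightarrow>\<^sub>M tree_borel \<zeta>"
proof -
  interpret Metric_space "tree \<zeta>" "tree_dist \<zeta>" by (rule Metric_space_tree)
  have "tree_proj \<zeta> -` U \<inter> {0..\<sigma>} \<in> sets (restrict_space borel {0..\<sigma>})"
    if U: "openin mtopology U" for U
  proof -
    let ?V = "tree_proj \<zeta> -` U \<inter> {0..}"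
    have "\<exists>e>0. \<forall>t\<in>{0..}. dist t s < e \<longrightarrow> t \<in> ?V" if s: "s \<in> ?V" for s
    proof -
      obtain r where r: "r > 0" "mball (tree_proj \<zeta> s) r \<subseteq> U"
        using U s unfolding openin_mtopology by blast
      obtain e where e: "e > 0" "\<And>t. t \<in> {0..} \<Longrightarrow> dist t s < e \<Longrightarrow> dist (\<zeta> t) (\<zeta> s) < r / 4"
        using cont[unfolded continuous_on_iff, rule_format, of s "r / 4"] s r(1) by auto
      have "t \<in> ?V" if t: "t \<in> {0..}" "dist t s < e" for t
      proof -
        have "\<zeta> s - r / 4 \<le> height_min \<zeta> s t"
        proof (rule height_min_greatest)
          fix u assume "u \<in> {min s t..max s t}"
          then have "u \<in> {0..}" "dist u s < e"
            using s t by (auto simp: dist_real_def min_def max_def split: if_splits)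
          from e(2)[OF this] show "\<zeta> s - r / 4 \<le> \<zeta> u" unfolding dist_real_def by linarith
        qed
        then have "height_dist \<zeta> s t < r"
          using e(2)[OF t] r(1) unfolding height_dist_def dist_real_def by linarith
        then have "tree_proj \<zeta> t \<in> mball (tree_proj \<zeta> s) r"
          using s t by (auto simp: tree_dist_proj tree_proj_mem)
        then show ?thesis using r t by auto
      qed
      then show ?thesis using e(1) by blast
    qed
    then have "openin (top_of_set {0..}) ?V"
      unfolding openin_euclidean_subtopology_iff by auto
    then obtain W where W: "open W" "?V = {0..} \<inter> W"
      unfolding openin_open by blast
    have sub: "{0..\<sigma>} = {0..} \<inter> {0..\<sigma>}"
      by auto
    have "tree_proj \<zeta> -` U \<inter> {0..\<sigma>} = {0..\<sigma>} \<inter> W"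
      using W(2) sub by blast
    moreover have "W \<in> sets borel"
      using W(1) by simp
    ultimately show ?thesis
      unfolding sets_restrict_space by blast
  qed
  then show ?thesis
    unfolding tree_borel_def tree_topology_def
    using openin_subset[of mtopology]
    by (intro measurable_measure_of)
       (auto simp: space_restrict_space sets_restrict_space tree_proj_mem)
qed

end

end

theory Submission
  imports Defs "HOL-Real_Asymp.Real_Asymp"
begin

text \<open>
  A point \<open>x\<close> is cut from the root at time \<open>\<theta>(x)\<close>, so \<open>\<Theta>\<close> is the integral over \<open>u > 0\<close> of \<open>g(u)\<close>, the
  mass of the points that are still attached at time \<open>u\<close>. Ordering the \<open>r\<close> times in the \<open>r\<close>-th power
  gives
  \<open>\<Theta>\<^sup>r = r! \<integral>\<^bsub>q\<^sub>1 > \<dots> > q\<^sub>r > 0\<^esub> g(q\<^sub>1) \<dots> g(q\<^sub>r) dq\<close> (\<open>power_eq_simplex_integral\<close>). By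
  Tonelli the expectation becomes an integral, over \<open>x\<^sub>1, \<dots>, x\<^sub>r\<close> and over decreasing \<open>q\<close>, of the
  probability that \<open>\<theta>(x\<^sub>i) > q\<^sub>i\<close> for all \<open>i\<close>. Up to a null event this means that no mark falls in the
  staircase \<open>\<Union>\<^sub>i \<lbrakk>\<emptyset>, x\<^sub>i\<rbrakk> \<times> [0, q\<^sub>i]\<close>.

  The decreasing order makes the intensity of the staircase easy: whatever the branch of \<open>x\<^sub>i\<close> shares
  with earlier branches is already covered up to a later time, so \<open>x\<^sub>i\<close> contributes only the length
  \<open>\<ell>\<^sub>i - \<ell>\<^bsub>i-1\<^esub>\<close> of the new piece, where \<open>\<ell>\<^sub>i\<close> is the length of the subtree spanned by
  \<open>x\<^sub>1, \<dots>, x\<^sub>i\<close>. With \<open>c = 2 \<alpha>\<close> the void probability is thus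
  \<open>exp (- c \<Sum>\<^sub>i (\<ell>\<^sub>i - \<ell>\<^bsub>i-1\<^esub>) q\<^sub>i)\<close> (\<open>mark_time_survival_probability\<close>). Integrating the times out from the
  largest to the smallest telescopes the rates: once \<open>q\<^sub>1, \<dots>, q\<^bsub>i-1\<^esub>\<close> are gone, \<open>q\<^sub>i\<close> carries the rate
  \<open>c \<ell>\<^sub>i\<close>, so the integral is \<open>\<Prod>\<^sub>i 1 / (c \<ell>\<^sub>i)\<close> (\<open>simplex_integral_exp\<close>), which is the claim.

  Two points need care. First, the metric enters only through the height of the meet of two points,
  which satisfies an ultrametric inequality; geodesics from the root become sets of ancestors, and
  the length of a spanned subtree becomes an explicit, measurable function of the points. Secondly,
  Tonelli needs \<open>\<theta>\<close> to be jointly measurable in the randomness and the point. For this \<open>\<theta>(x)\<close> is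
  replaced by the infimum of \<open>\<theta>(z)\<close> over the ancestors \<open>z\<close> of \<open>x\<close> in a fixed countable set, which
  agrees with \<open>\<theta>\<close> at almost every point for every realisation, and almost surely at every given
  point.
\<close>

section \<open>Integrals over decreasing tuples\<close>

lemma emeasure_lborel_greaterThan: "emeasure lborel {a::real<..} = \<infinity>"
proof (rule ccontr)
  assume "emeasure lborel {a<..} \<noteq> \<infinity>"
  then obtain c where c: "emeasure lborel {a<..} = ennreal c" "0 \<le> c"
    by (cases "emeasure lborel {a<..}") auto
  have "ennreal (c + 1) = emeasure lborel {a<..<a + (c + 1)}" using c by simp
  also have "\<dots> \<le> emeasure lborel {a<..}" by (rule emeasure_mono) auto
  finally show False using c by simp
qed

text \<open>Decreasing tuples are bounded below rather than above, so that the last coordinate is the one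
  that is split off in inductions on the number of coordinates.\<close>
definition decreasing_above :: "nat \<Rightarrow> real \<Rightarrow> (nat \<Rightarrow> real) \<Rightarrow> bool" where
  "decreasing_above n a q \<longleftrightarrow>
     (\<forall>i\<in>{1..n}. a < q i) \<and> (\<forall>i\<in>{1..n}. \<forall>j\<in>{1..n}. i < j \<longrightarrow> q j < q i)"

definition simplex_integral :: "nat \<Rightarrow> real \<Rightarrow> (nat \<Rightarrow> real \<Rightarrow> ennreal) \<Rightarrow> ennreal" where
  "simplex_integral n a f =
     (\<integral>\<^sup>+q. indicator (Collect (decreasing_above n a)) q * (\<Prod>i=1..n. f i (q i)) \<partial>PiM {1..n} (\<lambda>_. lborel))"

lemma decreasing_above_Suc:
  "decreasing_above (Suc n) a (q(Suc n := u)) \<longleftrightarrow> a < u \<and> decreasing_above n u q"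
proof
  assume *: "decreasing_above (Suc n) a (q(Suc n := u))"
  have "u < q i" if "i \<in> {1..n}" for i
    using *[unfolded decreasing_above_def, THEN conjunct2, rule_format, of i "Suc n"] that by auto
  moreover have "a < u"
    using *[unfolded decreasing_above_def, THEN conjunct1, rule_format, of "Suc n"] by auto
  moreover have "q j < q i" if "i \<in> {1..n}" "j \<in> {1..n}" "i < j" for i j
    using *[unfolded decreasing_above_def, THEN conjunct2, rule_format, of i j] that by auto
  ultimately show "a < u \<and> decreasing_above n u q"
    by (auto simp: decreasing_above_def)
next
  assume *: "a < u \<and> decreasing_above n u q"
  then have u: "u < q i" if "i \<in> {1..n}" for i
    using that unfolding decreasing_above_def by blast
  have "a < q i" if "i \<in> {1..n}" for i
    using u[OF that] * by linarith
  with * u show "decreasing_above (Suc n) a (q(Suc n := u))"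
    unfolding decreasing_above_def atLeastAtMostSuc_conv[of 1 n, simplified]
    by simp
qed

lemma decreasing_above_measurable [measurable]:
  "Measurable.pred (PiM {1..n} (\<lambda>_. lborel)) (decreasing_above n a)"
  unfolding decreasing_above_def[abs_def] by measurable

interpretation lborel_product: product_sigma_finite "\<lambda>_::nat. lborel :: real measure"
  by standard

lemma simplex_integral_0: "simplex_integral 0 a f = 1"
  by (simp add: simplex_integral_def decreasing_above_def PiM_empty nn_integral_count_space_finite)

text \<open>Tonelli in the last coordinate \<open>u\<close>, which is the lower bound of the others.\<close>
lemma simplex_integral_Suc:
  assumes [measurable]: "\<And>i. f i \<in> borel_measurable borel"
  shows "simplex_integral (Suc n) a f =
    (\<integral>\<^sup>+u. indicator {a<..} u * (f (Suc n) u * simplex_integral n u f) \<partial>lborel)"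
proof -
  have ins: "{1..Suc n} = insert (Suc n) {1..n}" by auto
  let ?F = "\<lambda>q. indicator (Collect (decreasing_above (Suc n) a)) q * (\<Prod>i=1..Suc n. f i (q i))"
  have F: "?F \<in> borel_measurable (PiM (insert (Suc n) {1..n}) (\<lambda>_. lborel))"
    unfolding ins[symmetric] by measurable
  have "simplex_integral (Suc n) a f =
      (\<integral>\<^sup>+u. (\<integral>\<^sup>+q. ?F (q(Suc n := u)) \<partial>PiM {1..n} (\<lambda>_. lborel)) \<partial>lborel)"
    unfolding simplex_integral_def ins by (rule lborel_product.product_nn_integral_insert_rev)
      (use F in \<open>simp_all only: ins finite_atLeastAtMost, simp_all\<close>)
  also have "\<dots> = (\<integral>\<^sup>+u. indicator {a<..} u * (f (Suc n) u * simplex_integral n u f) \<partial>lborel)"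
  proof (rule nn_integral_cong)
    fix u :: real
    have F_eq: "?F (q(Suc n := u)) = (indicator {a<..} u * f (Suc n) u) *
        (indicator (Collect (decreasing_above n u)) q * (\<Prod>i=1..n. f i (q i)))" for q
    proof -
      have "(\<Prod>i=1..n. f i ((q(Suc n := u)) i)) = (\<Prod>i=1..n. f i (q i))"
        by (rule prod.cong) auto
      then show ?thesis
        by (auto simp: ins decreasing_above_Suc indicator_def simp del: One_nat_def)
    qed
    show "(\<integral>\<^sup>+q. ?F (q(Suc n := u)) \<partial>PiM {1..n} (\<lambda>_. lborel)) =
        indicator {a<..} u * (f (Suc n) u * simplex_integral n u f)"
      unfolding F_eq simplex_integral_def
      by (subst nn_integral_cmult) (measurable, simp add: mult.assoc)
  qed
  finally show ?thesis .
qed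

text \<open>The fundamental theorem of calculus for \<open>G\<^sup>r\<^sup>+\<^sup>1\<close>, whose derivative is \<open>- (r + 1) g G\<^sup>r\<close>. As \<open>g\<close> is
  merely measurable, differentiation is replaced by a symmetry argument: in the product of
  \<open>G(a) = \<integral> g(v) dv\<close> and \<open>G(a)\<^sup>r\<^sup>+\<^sup>1 = (r + 1) \<integral> g(u) G(u)\<^sup>r du\<close> the part \<open>v > u\<close> and, after exchanging
  the integrals, the part \<open>v < u\<close> are both multiples of \<open>\<integral> g G\<^sup>r\<^sup>+\<^sup>1\<close>.\<close>
lemma upper_integral_power:
  fixes g :: "real \<Rightarrow> ennreal" and r :: nat
  assumes [measurable]: "g \<in> borel_measurable borel"
  defines "G \<equiv> \<lambda>a. \<integral>\<^sup>+u. indicator {a<..} u * g u \<partial>lborel"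
  shows "G a ^ Suc r = of_nat (Suc r) * (\<integral>\<^sup>+u. indicator {a<..} u * (g u * G u ^ r) \<partial>lborel)"
proof (induction r arbitrary: a)
  case 0
  then show ?case by (simp add: G_def)
next
  case (Suc r)
  have [measurable]: "G \<in> borel_measurable borel"
  proof -
    have "(\<lambda>a. \<integral>\<^sup>+u. indicator {p. fst p < snd p} (a, u) * g u \<partial>lborel) \<in> borel_measurable borel"
      by measurable
    then show ?thesis by (simp add: G_def indicator_def)
  qed
  have split: "G a = G u + (\<integral>\<^sup>+v. indicator {a<..<u} v * g v \<partial>lborel)" if "a < u" for u
  proof -
    have "G a = (\<integral>\<^sup>+v. indicator {u<..} v * g v + indicator {a<..<u} v * g v \<partial>lborel)"
      unfolding G_def using AE_lborel_singleton[of u]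
      by (intro nn_integral_cong_AE)
        (use that in \<open>auto simp: indicator_def elim!: eventually_mono\<close>)
    also have "\<dots> = G u + (\<integral>\<^sup>+v. indicator {a<..<u} v * g v \<partial>lborel)"
      unfolding G_def by (rule nn_integral_add) measurable
    finally show ?thesis .
  qed
  let ?n = "of_nat (Suc r) :: ennreal"
  let ?I = "\<integral>\<^sup>+u. indicator {a<..} u * (g u * G u ^ Suc r) \<partial>lborel"
  \<comment> \<open>What \<open>G a\<close> exceeds \<open>G u\<close> by.\<close>
  define K where "K u = (\<integral>\<^sup>+v. indicator {a<..<u} v * g v \<partial>lborel)" for u
  have [measurable]: "K \<in> borel_measurable borel"
  proof -
    have "(\<lambda>u. \<integral>\<^sup>+v. indicator {p. a < snd p \<and> snd p < fst p} (u, v) * g v \<partial>lborel) \<in> borel_measurable borel"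
      by measurable
    then show ?thesis by (simp add: K_def[abs_def] indicator_def)
  qed
  define T where "T v = (\<integral>\<^sup>+u. indicator {v<..} u * (g u * G u ^ r) \<partial>lborel)" for v
  have [measurable]: "T \<in> borel_measurable borel"
  proof -
    have "(\<lambda>v. \<integral>\<^sup>+u. indicator {p. fst p < snd p} (v, u) * (g u * G u ^ r) \<partial>lborel) \<in> borel_measurable borel"
      by measurable
    then show ?thesis by (simp add: T_def[abs_def] indicator_def)
  qed
  have cross: "?n * (\<integral>\<^sup>+u. indicator {a<..} u * (g u * G u ^ r * K u) \<partial>lborel) = ?I"
  proof -
    have "(\<integral>\<^sup>+u. indicator {a<..} u * (g u * G u ^ r * K u) \<partial>lborel) =
        (\<integral>\<^sup>+u. \<integral>\<^sup>+v. indicator {p. a < snd p \<and> snd p < fst p} (u, v) * (g v * (g u * G u ^ r)) \<partial>lborel \<partial>lborel)"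
    proof (rule nn_integral_cong)
      fix u
      have "indicator {a<..} u * (g u * G u ^ r * K u) =
          (indicator {a<..} u * (g u * G u ^ r)) * (\<integral>\<^sup>+v. indicator {a<..<u} v * g v \<partial>lborel)"
        by (simp add: K_def mult_ac)
      also have "\<dots> = (\<integral>\<^sup>+v. (indicator {a<..} u * (g u * G u ^ r)) * (indicator {a<..<u} v * g v) \<partial>lborel)"
        by (rule nn_integral_cmult[symmetric]) measurable
      also have "\<dots> = (\<integral>\<^sup>+v. indicator {p. a < snd p \<and> snd p < fst p} (u, v) * (g v * (g u * G u ^ r)) \<partial>lborel)"
        by (intro nn_integral_cong) (auto simp: indicator_def mult_ac)
      finally show "indicator {a<..} u * (g u * G u ^ r * K u) = \<dots>" .
    qed
    also have "\<dots> = (\<integral>\<^sup>+v. \<integral>\<^sup>+u. indicator {p. a < snd p \<and> snd p < fst p} (u, v) * (g v * (g u * G u ^ r)) \<partial>lborel \<partial>lborel)"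
      by (rule lborel_pair.Fubini') measurable
    also have "\<dots> = (\<integral>\<^sup>+v. (indicator {a<..} v * g v) * T v \<partial>lborel)"
      unfolding T_def by (subst nn_integral_cmult[symmetric], measurable)
        (auto intro!: nn_integral_cong simp: indicator_def)
    finally have eq: "(\<integral>\<^sup>+u. indicator {a<..} u * (g u * G u ^ r * K u) \<partial>lborel) =
        (\<integral>\<^sup>+v. (indicator {a<..} v * g v) * T v \<partial>lborel)" .
    have "?n * (\<integral>\<^sup>+u. indicator {a<..} u * (g u * G u ^ r * K u) \<partial>lborel) =
        (\<integral>\<^sup>+v. ?n * ((indicator {a<..} v * g v) * T v) \<partial>lborel)"
      unfolding eq by (rule nn_integral_cmult[symmetric]) measurable
    also have "\<dots> = ?I"
    proof (rule nn_integral_cong)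
      fix v
      have "?n * ((indicator {a<..} v * g v) * T v) = indicator {a<..} v * (g v * (?n * T v))"
        by (simp only: mult_ac)
      then show "?n * ((indicator {a<..} v * g v) * T v) = indicator {a<..} v * (g v * G v ^ Suc r)"
        by (simp only: Suc.IH T_def)
    qed
    finally show ?thesis .
  qed
  have "G a ^ Suc (Suc r) = ?n * ((\<integral>\<^sup>+u. indicator {a<..} u * (g u * G u ^ r) \<partial>lborel) * G a)"
    by (simp only: power_Suc2[of _ "Suc r"] Suc.IH mult.assoc)
  also have "(\<integral>\<^sup>+u. indicator {a<..} u * (g u * G u ^ r) \<partial>lborel) * G a =
      (\<integral>\<^sup>+u. indicator {a<..} u * (g u * G u ^ r) * G a \<partial>lborel)"
    by (rule nn_integral_multc[symmetric]) measurable
  also have "\<dots> =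
      (\<integral>\<^sup>+u. indicator {a<..} u * (g u * G u ^ Suc r) + indicator {a<..} u * (g u * G u ^ r * K u) \<partial>lborel)"
  proof (rule nn_integral_cong)
    fix u
    show "indicator {a<..} u * (g u * G u ^ r) * G a =
        indicator {a<..} u * (g u * G u ^ Suc r) + indicator {a<..} u * (g u * G u ^ r * K u)"
    proof (cases "a < u")
      case True
      then have "G a = G u + K u" using split by (simp add: K_def)
      then show ?thesis by (simp add: distrib_left mult_ac)
    qed simp
  qed
  also have "\<dots> = ?I + (\<integral>\<^sup>+u. indicator {a<..} u * (g u * G u ^ r * K u) \<partial>lborel)"
    by (rule nn_integral_add) measurable
  also have "?n * \<dots> = of_nat (Suc (Suc r)) * ?I"
    unfolding distrib_left cross by (simp add: distrib_right add_ac)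
  finally show ?case .
qed

text \<open>All \<open>r!\<close> orderings of the coordinates contribute equally to the power of an integral, and ties
  have measure zero.\<close>
lemma power_eq_simplex_integral:
  fixes g :: "real \<Rightarrow> ennreal"
  assumes [measurable]: "g \<in> borel_measurable borel"
  shows "(\<integral>\<^sup>+u. indicator {a<..} u * g u \<partial>lborel) ^ r = fact r * simplex_integral r a (\<lambda>_. g)"
proof (induction r arbitrary: a)
  case 0
  then show ?case by (simp add: simplex_integral_0)
next
  case (Suc r)
  have [measurable]: "(\<lambda>a. simplex_integral r a (\<lambda>_. g)) \<in> borel_measurable borel"
  proof -
    have "(\<lambda>a. \<integral>\<^sup>+u. indicator {p. fst p < snd p} (a, u) * g u \<partial>lborel) \<in> borel_measurable borel"
      by measurable
    then have "(\<lambda>a. (\<integral>\<^sup>+u. indicator {a<..} u * g u \<partial>lborel) ^ r / fact r) \<in> borel_measurable borel"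
      by (simp add: indicator_def)
    moreover have "(\<integral>\<^sup>+u. indicator {a<..} u * g u \<partial>lborel) ^ r / fact r = simplex_integral r a (\<lambda>_. g)" for a
    proof -
      have "(fact r :: ennreal) = of_nat (fact r)" by simp
      then have "(fact r :: ennreal) \<noteq> 0" "(fact r :: ennreal) \<noteq> top"
        by (metis fact_nonzero of_nat_eq_0_iff, metis ennreal_of_nat_neq_top)
      then show ?thesis by (simp add: Suc.IH ennreal_mult_divide_eq mult.commute[of "fact r"])
    qed
    ultimately show ?thesis by simp
  qed
  have "(\<integral>\<^sup>+u. indicator {a<..} u * g u \<partial>lborel) ^ Suc r = of_nat (Suc r) *
      (\<integral>\<^sup>+u. indicator {a<..} u * (g u * (fact r * simplex_integral r u (\<lambda>_. g))) \<partial>lborel)"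
    by (subst upper_integral_power) (measurable, simp only: Suc.IH)
  also have "(\<integral>\<^sup>+u. indicator {a<..} u * (g u * (fact r * simplex_integral r u (\<lambda>_. g))) \<partial>lborel) =
      fact r * (\<integral>\<^sup>+u. indicator {a<..} u * (g u * simplex_integral r u (\<lambda>_. g)) \<partial>lborel)"
    by (subst nn_integral_cmult[symmetric]) (measurable, simp only: mult_ac)
  also have "(\<integral>\<^sup>+u. indicator {a<..} u * (g u * simplex_integral r u (\<lambda>_. g)) \<partial>lborel) =
      simplex_integral (Suc r) a (\<lambda>_. g)"
    by (rule simplex_integral_Suc[symmetric]) measurable
  finally show ?case by (simp only: fact_Suc mult.assoc of_nat_mult)
qed

lemma nn_integral_exp_above:
  fixes l a :: real
  assumes "0 \<le> l"
  shows "(\<integral>\<^sup>+u. indicator {a<..} u * ennreal (exp (- l * u)) \<partial>lborel) = ennreal (exp (- l * a)) / ennreal l"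
proof (cases "l = 0")
  case True
  then show ?thesis by (simp add: emeasure_lborel_greaterThan ennreal_divide_zero)
next
  case False
  then have l: "0 < l" using assms by simp
  have "(\<integral>\<^sup>+u. indicator {a<..} u * ennreal (exp (- l * u)) \<partial>lborel) =
      (\<integral>\<^sup>+u. ennreal (exp (- l * u)) * indicator {a..} u \<partial>lborel)"
    using AE_lborel_singleton[of a]
    by (intro nn_integral_cong_AE) (auto simp: indicator_def elim!: eventually_mono)
  also have "\<dots> = ennreal (0 - (- exp (- l * a) / l))"
  proof (rule nn_integral_FTC_atLeast)
    have "((\<lambda>x. exp (- l * x)) \<longlongrightarrow> 0) at_top"
      using l by real_asymp
    then show "((\<lambda>x. - exp (- l * x) / l) \<longlongrightarrow> 0) at_top"
      using tendsto_divide[OF tendsto_minus tendsto_const[of l]] l by fastforce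
  qed (use l in \<open>auto intro!: derivative_eq_intros\<close>)
  also have "\<dots> = ennreal (exp (- l * a)) / ennreal l"
    using l by (simp add: divide_ennreal)
  finally show ?thesis .
qed

text \<open>The rates telescope: after integrating over the first \<open>n\<close> coordinates down to \<open>u\<close>, the factor
  \<open>exp (- l n * u)\<close> remains and turns the rate \<open>l (Suc n) - l n\<close> of \<open>u\<close> into \<open>l (Suc n)\<close>. For
  \<open>l i = 0\<close> both sides are infinite.\<close>
lemma simplex_integral_exp:
  fixes l :: "nat \<Rightarrow> real"
  assumes l: "\<And>i. 0 \<le> l i" and l0: "l 0 = 0"
  shows "simplex_integral n a (\<lambda>i u. ennreal (exp (- (l i - l (i - 1)) * u))) =
    ennreal (exp (- l n * a)) * (\<Prod>i=1..n. 1 / ennreal (l i))"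
proof (induction n arbitrary: a)
  case 0
  then show ?case by (simp add: simplex_integral_0 l0)
next
  case (Suc n)
  have "simplex_integral (Suc n) a (\<lambda>i u. ennreal (exp (- (l i - l (i - 1)) * u))) =
      (\<integral>\<^sup>+u. indicator {a<..} u * ennreal (exp (- l (Suc n) * u)) * (\<Prod>i=1..n. 1 / ennreal (l i)) \<partial>lborel)"
  proof (subst simplex_integral_Suc)
    have e: "ennreal (exp (- (l (Suc n) - l n) * u)) * ennreal (exp (- l n * u)) =
        ennreal (exp (- l (Suc n) * u))" for u
      by (simp add: ennreal_mult[symmetric] exp_add[symmetric] left_diff_distrib)
    show "(\<integral>\<^sup>+u. indicator {a<..} u * (ennreal (exp (- (l (Suc n) - l (Suc n - 1)) * u)) *
          simplex_integral n u (\<lambda>i u. ennreal (exp (- (l i - l (i - 1)) * u)))) \<partial>lborel) =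
        (\<integral>\<^sup>+u. indicator {a<..} u * ennreal (exp (- l (Suc n) * u)) * (\<Prod>i=1..n. 1 / ennreal (l i)) \<partial>lborel)"
      by (rule nn_integral_cong) (simp only: Suc.IH e[symmetric] mult.assoc diff_Suc_1)
  qed measurable
  also have "\<dots> = ennreal (exp (- l (Suc n) * a)) / ennreal (l (Suc n)) * (\<Prod>i=1..n. 1 / ennreal (l i))"
    by (subst nn_integral_multc, measurable) (simp only: nn_integral_exp_above[OF l])
  also have "\<dots> = ennreal (exp (- l (Suc n) * a)) * (\<Prod>i=1..Suc n. 1 / ennreal (l i))"
    by (simp add: divide_ennreal_def mult_ac)
  finally show ?case .
qed

lemma ennreal_eq_integral_below:
  "y = (\<integral>\<^sup>+u. indicator {0<..} u * (if ennreal u < y then 1 else 0) \<partial>lborel)"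
proof (cases y)
  case (real b)
  have "(\<integral>\<^sup>+u. indicator {0<..} u * (if ennreal u < y then 1 else 0) \<partial>lborel) =
      (\<integral>\<^sup>+u. indicator {0<..<b} u \<partial>lborel)"
    using real by (intro nn_integral_cong) (auto simp: indicator_def ennreal_less_iff)
  then show ?thesis using real by simp
next
  case top
  have "(\<integral>\<^sup>+u. indicator {0<..} u * (if ennreal u < y then 1 else 0) \<partial>lborel) =
      (\<integral>\<^sup>+u. indicator {0<..} (u::real) \<partial>lborel)"
    using top by (intro nn_integral_cong) (auto simp: indicator_def)
  then show ?thesis using top by (simp add: emeasure_lborel_greaterThan)
qed

text \<open>Inversion is multiplicative on finite extended reals, zero included: the inverse of a finite factor
  is positive, so it cannot cancel \<open>1 / 0 = \<infinity>\<close>.\<close>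
lemma ennreal_one_divide_prod:
  assumes c: "0 < c" and l: "\<And>i. i \<in> I \<Longrightarrow> 0 \<le> l i" and "finite I"
  shows "(\<Prod>i\<in>I. 1 / ennreal (c * l i)) = ennreal (1 / c ^ card I) * (1 / (\<Prod>i\<in>I. ennreal (l i)))"
  using \<open>finite I\<close> l
proof (induction I rule: finite_induct)
  case empty
  then show ?case by simp
next
  case (insert i I)
  have inverse_mult: "inverse (ennreal a * b) = inverse (ennreal a) * inverse b" if "b < top" for a b
    using that by (intro ennreal_inverse_mult) auto
  have fin: "(\<Prod>i\<in>I. ennreal (l i)) < top"
    using insert.prems by (subst prod_ennreal) auto
  have "inverse (ennreal (c * l i)) = ennreal (1 / c) * inverse (ennreal (l i))"
    using c insert.prems by (simp add: ennreal_mult inverse_mult inverse_ennreal divide_inverse)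
  moreover have "ennreal (1 / c ^ card (insert i I)) = ennreal (1 / c) * ennreal (1 / c ^ card I)"
    using c insert.hyps by (simp add: ennreal_mult[symmetric])
  ultimately show ?case
    using insert fin by (simp add: divide_ennreal_def inverse_mult mult_ac)
qed

section \<open>Genealogy of a coded tree\<close>

locale coded_tree =
  fixes \<zeta> :: "real \<Rightarrow> real" and \<sigma> :: real
  assumes height_function: "height_function \<zeta> \<sigma>"
begin

abbreviation "origin \<equiv> tree_root \<zeta>"

definition height :: "real set \<Rightarrow> real" where
  "height x = tree_dist \<zeta> origin x"

text \<open>The height of the most recent common ancestor; in terms of the coding function it is the minimum
  of \<open>\<zeta>\<close> between two preimages.\<close>
definition meet_height :: "real set \<Rightarrow> real set \<Rightarrow> real" where
  "meet_height x y = (height x + height y - tree_dist \<zeta> x y) / 2"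

definition ancestor :: "real set \<Rightarrow> real set \<Rightarrow> bool" where
  "ancestor w x \<longleftrightarrow> w \<in> tree \<zeta> \<and> x \<in> tree \<zeta> \<and> meet_height w x = height w"

lemma code_nonneg: "0 \<le> s \<Longrightarrow> 0 \<le> \<zeta> s"
  using height_function by (simp add: height_function_def)

lemma code_continuous: "continuous_on {0..} \<zeta>"
  using height_function by (simp add: height_function_def)

lemma code_zero: "\<zeta> 0 = 0"
  using height_function by (simp add: height_function_def)

lemma sigma_nonneg: "0 \<le> \<sigma>"
  using height_function by (simp add: height_function_def)

sublocale Metric_space "tree \<zeta>" "tree_dist \<zeta>"
  by (rule Metric_space_tree) (rule code_nonneg)

text \<open>The coding function is instantiated explicitly since higher-order unification would otherwise
  also consider reparametrised coding functions.\<close>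
lemmas tree_proj_in = tree_proj_mem[where \<zeta> = \<zeta>, OF code_nonneg]
lemmas tree_dist_tree_proj = tree_dist_proj[where \<zeta> = \<zeta>, OF code_nonneg]
lemmas tree_point = tree_cases[where \<zeta> = \<zeta>, OF code_nonneg]
lemmas height_min_ge = height_min_greatest[where \<zeta> = \<zeta>, OF code_nonneg]
lemmas height_min_lower = height_min_le[where \<zeta> = \<zeta>, OF code_nonneg]

lemma root_in [simp]: "origin \<in> tree \<zeta>"
  by (simp add: tree_root_def tree_proj_in)

lemma height_min_zero: "0 \<le> s \<Longrightarrow> height_min \<zeta> 0 s = 0"
proof -
  assume s: "0 \<le> s"
  have "height_min \<zeta> 0 s \<le> 0"
    using height_min_lower[of 0 s 0] s by (simp add: code_zero)
  moreover have "0 \<le> height_min \<zeta> 0 s"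
    by (rule height_min_ge) (use s in \<open>auto intro: code_nonneg\<close>)
  ultimately show ?thesis by simp
qed

lemma height_proj: "0 \<le> s \<Longrightarrow> height (tree_proj \<zeta> s) = \<zeta> s"
  by (simp add: height_def tree_root_def tree_dist_tree_proj height_dist_def height_min_zero code_zero)

lemma meet_height_proj:
  "0 \<le> s \<Longrightarrow> 0 \<le> t \<Longrightarrow> meet_height (tree_proj \<zeta> s) (tree_proj \<zeta> t) = height_min \<zeta> s t"
  by (simp add: meet_height_def height_proj tree_dist_tree_proj height_dist_def)

lemma height_root [simp]: "height origin = 0"
  by (simp add: height_def)

lemma height_nonneg [simp]: "0 \<le> height x"
  by (simp add: height_def)

lemma meet_height_commute: "meet_height x y = meet_height y x"
  by (simp add: meet_height_def commute)

lemma meet_height_self: "x \<in> tree \<zeta> \<Longrightarrow> meet_height x x = height x"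
  by (simp add: meet_height_def)

lemma meet_height_le:
  assumes "x \<in> tree \<zeta>" "y \<in> tree \<zeta>"
  shows "meet_height x y \<le> height x"
  using triangle[of origin x y] assms by (simp add: meet_height_def height_def)

lemma meet_height_le':
  assumes "x \<in> tree \<zeta>" "y \<in> tree \<zeta>"
  shows "meet_height x y \<le> height y"
  using meet_height_le[of y x] assms by (simp add: meet_height_commute)

lemma meet_height_nonneg:
  assumes "x \<in> tree \<zeta>" "y \<in> tree \<zeta>"
  shows "0 \<le> meet_height x y"
  using triangle[of x origin y] assms by (simp add: meet_height_def height_def commute)

text \<open>An interval of codes from \<open>x\<close> to \<open>z\<close> is covered by one from \<open>x\<close> to \<open>y\<close> and one from \<open>y\<close> to \<open>z\<close>. This
  inequality carries the whole tree structure used below.\<close>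
lemma meet_height_ultrametric:
  assumes "x \<in> tree \<zeta>" "y \<in> tree \<zeta>" "z \<in> tree \<zeta>"
  shows "min (meet_height x y) (meet_height y z) \<le> meet_height x z"
proof -
  obtain s t u where st: "0 \<le> s" "x = tree_proj \<zeta> s" "0 \<le> t" "y = tree_proj \<zeta> t"
      "0 \<le> u" "z = tree_proj \<zeta> u"
    using assms by (metis tree_point)
  have "min (height_min \<zeta> s t) (height_min \<zeta> t u) \<le> height_min \<zeta> s u"
  proof (rule height_min_ge)
    fix v assume "v \<in> {min s u..max s u}"
    then have "v \<in> {min s t..max s t} \<or> v \<in> {min t u..max t u}"
      by (auto simp: min_def max_def split: if_splits)
    then show "min (height_min \<zeta> s t) (height_min \<zeta> t u) \<le> \<zeta> v"
      using height_min_lower[of s t v] height_min_lower[of t u v] st by (auto simp: min_le_iff_disj)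
  qed
  then show ?thesis using st by (simp add: meet_height_proj)
qed

lemma ancestorD:
  assumes "ancestor w x"
  shows "w \<in> tree \<zeta>" "x \<in> tree \<zeta>" "meet_height w x = height w"
  using assms by (auto simp: ancestor_def)

lemma ancestor_iff_le:
  "w \<in> tree \<zeta> \<Longrightarrow> x \<in> tree \<zeta> \<Longrightarrow> ancestor w x \<longleftrightarrow> height w \<le> meet_height w x"
  using meet_height_le[of w x] by (auto simp: ancestor_def)

lemma ancestor_refl: "x \<in> tree \<zeta> \<Longrightarrow> ancestor x x"
  by (simp add: ancestor_def meet_height_self)

lemma ancestor_height_le: "ancestor w x \<Longrightarrow> height w \<le> height x"
  using meet_height_le'[of w x] by (auto simp: ancestor_def)

lemma ancestor_trans:
  assumes "ancestor w y" "ancestor y x" shows "ancestor w x"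
  using assms meet_height_ultrametric[of w y x] ancestor_height_le[OF assms(1)]
  by (subst ancestor_iff_le) (auto simp: ancestor_def)

text \<open>Two points share exactly the ancestors up to the height of their meet.\<close>
lemma ancestor_both_iff:
  assumes "ancestor w x" "y \<in> tree \<zeta>"
  shows "ancestor w y \<longleftrightarrow> height w \<le> meet_height x y"
  using assms meet_height_ultrametric[of w x y] meet_height_ultrametric[of x w y]
  by (subst ancestor_iff_le) (auto simp: ancestor_def meet_height_commute[of x w] min_def split: if_splits)

lemma ancestors_dist:
  assumes "ancestor w x" "ancestor y x"
  shows "tree_dist \<zeta> w y = \<bar>height w - height y\<bar>"
proof -
  have "min (height w) (height y) \<le> meet_height w y"
    using meet_height_ultrametric[of w x y] assms
    by (simp add: ancestor_def meet_height_commute[of x y])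
  moreover have "meet_height w y \<le> min (height w) (height y)"
    using meet_height_le[of w y] meet_height_le'[of w y] assms by (simp add: ancestor_def)
  ultimately have "meet_height w y = min (height w) (height y)" by simp
  then show ?thesis by (simp add: meet_height_def min_def split: if_splits)
qed

lemma ancestors_eqI:
  assumes "ancestor w x" "ancestor y x" "height w = height y"
  shows "w = y"
  using ancestors_dist[OF assms(1,2)] assms by (auto simp: ancestor_def)

text \<open>The ancestor of \<open>p(s)\<close> at height \<open>c\<close> is \<open>p(v)\<close> for the last time \<open>v\<close> before \<open>s\<close> at which \<open>\<zeta>\<close> is at
  most \<open>c\<close>.\<close>
lemma ancestor_at_height:
  assumes x: "x \<in> tree \<zeta>" and c: "0 \<le> c" "c \<le> height x"
  shows "\<exists>w. ancestor w x \<and> height w = c"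
proof -
  obtain s where s: "0 \<le> s" "x = tree_proj \<zeta> s" using x tree_point by blast
  define K where "K = {0..s} \<inter> \<zeta> -` {..c}"
  have "closed K" unfolding K_def
    by (rule continuous_closed_preimage) (auto intro: continuous_on_subset[OF code_continuous])
  moreover have "0 \<in> K" "bdd_above K" using s c by (auto simp: K_def code_zero)
  ultimately have vK: "Sup K \<in> K" by (intro closed_contains_Sup) auto
  \<comment> \<open>The last time before \<open>s\<close> at which \<open>\<zeta>\<close> is at most \<open>c\<close>.\<close>
  define v where "v = Sup K"
  have v: "0 \<le> v" "v \<le> s" "\<zeta> v \<le> c" using vK by (auto simp: K_def v_def)
  have above: "c < \<zeta> u" if "v < u" "u \<le> s" for u
  proof (rule ccontr)
    assume "\<not> c < \<zeta> u"
    then have "u \<in> K" using that v by (auto simp: K_def)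
    then have "u \<le> v" unfolding v_def using \<open>bdd_above K\<close> by (rule cSup_upper)
    then show False using that by simp
  qed
  have "\<zeta> v = c"
  proof (rule ccontr)
    assume "\<zeta> v \<noteq> c"
    then have "\<zeta> v < c" using v by simp
    moreover have "c \<le> \<zeta> s" using c s by (simp add: height_proj)
    ultimately obtain u where "v \<le> u" "u \<le> s" "\<zeta> u = c"
      using IVT'[of \<zeta> v c s] v continuous_on_subset[OF code_continuous, of "{v..s}"] by auto
    then show False using above[of u] \<open>\<zeta> v \<noteq> c\<close> by (cases "v = u") auto
  qed
  moreover have "\<zeta> v \<le> height_min \<zeta> v s"
  proof (rule height_min_ge)
    fix u assume "u \<in> {min v s..max v s}"
    then show "\<zeta> v \<le> \<zeta> u" using v above[of u] \<open>\<zeta> v = c\<close> by (cases "u = v") auto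
  qed
  ultimately show ?thesis
    using v s by (intro exI[of _ "tree_proj \<zeta> v"])
      (simp add: ancestor_iff_le tree_proj_in height_proj meet_height_proj)
qed

lemma ancestor_iff_dist:
  "ancestor w x \<longleftrightarrow> w \<in> tree \<zeta> \<and> x \<in> tree \<zeta> \<and> height w + tree_dist \<zeta> w x = height x"
  by (auto simp: ancestor_def meet_height_def)

text \<open>Along an isometric path from the root the parameter is the height, so the path consists of
  ancestors of its endpoint. Conversely the ancestors of \<open>x\<close> at the successive heights form such a
  path, since two ancestors of the same point are as far apart as their heights.\<close>
lemma geodesic_root:
  assumes x: "x \<in> tree \<zeta>"
  shows "geodesic \<zeta> origin x = {w. ancestor w x}"
proof (intro equalityI subsetI)
  fix w assume "w \<in> geodesic \<zeta> origin x"
  then obtain f a where f: "isometric_path \<zeta> origin x f" and a: "a \<in> {0..height x}" "w = f a"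
    unfolding geodesic_def height_def by auto
  have f0: "f 0 = origin" "f (height x) = x" "f \<in> {0..height x} \<rightarrow> tree \<zeta>"
    and iso: "\<And>a b. a \<in> {0..height x} \<Longrightarrow> b \<in> {0..height x} \<Longrightarrow> tree_dist \<zeta> (f a) (f b) = \<bar>a - b\<bar>"
    using f by (auto simp: isometric_path_def height_def)
  have "height w = a" using iso[of 0 a] a f0 by (simp add: height_def)
  moreover have "tree_dist \<zeta> w x = height x - a" using iso[of a "height x"] a f0 by simp
  moreover have "w \<in> tree \<zeta>" using f0 a by auto
  ultimately show "w \<in> {w. ancestor w x}" using x by (simp add: ancestor_iff_dist)
next
  fix w assume "w \<in> {w. ancestor w x}"
  then have w: "ancestor w x" by simp
  define f where "f c = (SOME w. ancestor w x \<and> height w = c)" for c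
  have f: "ancestor (f c) x" "height (f c) = c" if "c \<in> {0..height x}" for c
    using someI_ex[OF ancestor_at_height[OF x, of c]] that unfolding f_def by auto
  have end0: "f 0 = origin"
  proof (rule ancestors_eqI[of _ x])
    show "ancestor origin x" using x by (simp add: ancestor_iff_dist height_def)
  qed (use f[of 0] in auto)
  have end1: "f (height x) = x"
    using f[of "height x"] ancestor_refl[OF x] by (intro ancestors_eqI[of _ x x]) auto
  have "isometric_path \<zeta> origin x f"
    unfolding isometric_path_def height_def[symmetric]
    using end0 end1 f(2) ancestorD(1)[OF f(1)] by (auto simp: ancestors_dist[OF f(1) f(1)])
  moreover have "f (height w) = w" "height w \<in> {0..height x}"
    using f[of "height w"] ancestor_height_le[OF w] by (auto intro!: ancestors_eqI[OF _ w])
  ultimately show "w \<in> geodesic \<zeta> origin x"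
    unfolding geodesic_def height_def[symmetric] by force
qed

definition branch :: "real set \<Rightarrow> real set set" where
  "branch x = {w. ancestor w x}"

lemma branch_mono: "ancestor z x \<Longrightarrow> branch z \<subseteq> branch x"
  by (auto simp: branch_def intro: ancestor_trans)

lemma branch_below:
  assumes "ancestor z x"
  shows "branch z = {w \<in> branch x. height w \<le> height z}"
  using assms ancestor_both_iff[of _ x z] ancestorD[OF assms] ancestor_height_le
  by (auto simp: branch_def meet_height_commute[of x z] intro: ancestor_trans)

text \<open>The set collects the points coded by minima of \<open>\<zeta>\<close> over rational intervals. If \<open>a\<close> lies strictly
  below \<open>x = p(s)\<close>, continuity provides a rational interval around \<open>s\<close> on which \<open>\<zeta>\<close> stays above
  the height of \<open>a\<close>; its minimum codes a point between \<open>a\<close> and \<open>x\<close>.\<close>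
lemma countable_separating_points:
  "\<exists>D. countable D \<and> D \<subseteq> tree \<zeta> \<and>
     (\<forall>a x. ancestor a x \<longrightarrow> a \<noteq> x \<longrightarrow> (\<exists>z\<in>D. ancestor a z \<and> ancestor z x))"
proof -
  have "\<exists>v\<in>{a..b}. \<forall>y\<in>{a..b}. \<zeta> v \<le> \<zeta> y" if "0 \<le> a" "a \<le> b" for a b
    using that by (intro continuous_attains_inf continuous_on_subset[OF code_continuous]) auto
  then obtain v where v: "\<And>a b. 0 \<le> a \<Longrightarrow> a \<le> b \<Longrightarrow> v a b \<in> {a..b} \<and> (\<forall>y\<in>{a..b}. \<zeta> (v a b) \<le> \<zeta> y)"
    by metis
  define D where "D = (\<lambda>(a,b). tree_proj \<zeta> (v a b)) ` {(a,b). a \<in> \<rat> \<and> b \<in> \<rat> \<and> 0 \<le> a \<and> a \<le> b}"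
  have "countable {(a::real,b::real). a \<in> \<rat> \<and> b \<in> \<rat> \<and> 0 \<le> a \<and> a \<le> b}"
    by (rule countable_subset[of _ "\<rat> \<times> \<rat>"]) (auto intro: countable_rat)
  then have "countable D" unfolding D_def by (rule countable_image)
  moreover have "D \<subseteq> tree \<zeta>" using v unfolding D_def by (force intro!: tree_proj_in)
  moreover have "\<exists>z\<in>D. ancestor w z \<and> ancestor z x" if wx: "ancestor w x" "w \<noteq> x" for w x
  proof -
    obtain s where s: "0 \<le> s" "x = tree_proj \<zeta> s"
      using ancestorD(2)[OF wx(1)] tree_point by blast
    have less: "height w < height x"
      using ancestor_height_le[OF wx(1)] ancestors_eqI[OF wx(1) ancestor_refl] ancestorD(2)[OF wx(1)] wx(2)
      by force
    then have "0 < \<zeta> s" using s height_nonneg[of w] unfolding s(2) height_proj[OF s(1)] by linarith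
    then have s0: "0 < s" using s by (metis code_zero less_eq_real_def less_irrefl)
    define e where "e = height x - height w"
    have e: "0 < e" using less by (simp add: e_def)
    obtain \<delta> where \<delta>: "\<delta> > 0" "\<And>t. 0 \<le> t \<Longrightarrow> \<bar>t - s\<bar> < \<delta> \<Longrightarrow> \<bar>\<zeta> t - \<zeta> s\<bar> < e"
      using code_continuous[unfolded continuous_on_iff, rule_format, of s e] s e
      by (auto simp: dist_real_def)
    obtain a where a: "a \<in> \<rat>" "max 0 (s - \<delta>) < a" "a < s"
      using Rats_dense_in_real[of "max 0 (s - \<delta>)" s] s0 \<delta> by auto
    obtain b where b: "b \<in> \<rat>" "s < b" "b < s + \<delta>"
      using Rats_dense_in_real[of s "s + \<delta>"] \<delta> by auto
    have ab: "0 \<le> a" "a \<le> b" using a b by auto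
    note vab = v[OF ab]
    let ?z = "tree_proj \<zeta> (v a b)"
    have v0: "0 \<le> v a b" using vab ab by auto
    have z: "?z \<in> D" using a b ab by (auto simp: D_def)
    have anc: "ancestor ?z x"
    proof -
      have "\<zeta> (v a b) \<le> height_min \<zeta> (v a b) s"
        by (rule height_min_ge) (use vab a b in \<open>auto simp: min_def max_def split: if_splits\<close>)
      then show ?thesis using s v0 by (simp add: ancestor_iff_le tree_proj_in meet_height_proj height_proj)
    qed
    have "\<bar>v a b - s\<bar> < \<delta>" using vab a b by auto
    then have "height w \<le> height ?z"
      using \<delta>(2)[of "v a b"] v0 s by (auto simp: height_proj e_def)
    then have "ancestor w ?z"
      using ancestor_both_iff[OF wx(1), of ?z] ancestorD[OF anc] by (simp add: meet_height_commute)
    with z anc show ?thesis by blast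
  qed
  ultimately show ?thesis by blast
qed

definition dense_points :: "real set set" where
  "dense_points = (SOME D. countable D \<and> D \<subseteq> tree \<zeta> \<and>
     (\<forall>a x. ancestor a x \<longrightarrow> a \<noteq> x \<longrightarrow> (\<exists>z\<in>D. ancestor a z \<and> ancestor z x)))"

lemma countable_dense_points: "countable dense_points"
  and dense_points_subset: "dense_points \<subseteq> tree \<zeta>"
  and dense_points_between:
    "ancestor a x \<Longrightarrow> a \<noteq> x \<Longrightarrow> \<exists>z\<in>dense_points. ancestor a z \<and> ancestor z x"
  using someI_ex[OF countable_separating_points] unfolding dense_points_def by blast+

lemma space_tree_borel [simp]: "space (tree_borel \<zeta>) = tree \<zeta>"
  unfolding tree_borel_def tree_topology_def
  using openin_subset[of mtopology] by (intro space_measure_of) auto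

lemma sets_tree_borel_open: "openin mtopology U \<Longrightarrow> U \<in> sets (tree_borel \<zeta>)"
  unfolding tree_borel_def tree_topology_def
  using openin_subset[of mtopology] by (subst sets_measure_of) auto

lemma tree_dist_measurable:
  assumes z: "z \<in> tree \<zeta>"
  shows "tree_dist \<zeta> z \<in> borel_measurable (tree_borel \<zeta>)"
proof (rule borel_measurableI_less)
  fix c
  have "{x \<in> space (tree_borel \<zeta>). tree_dist \<zeta> z x < c} = mball z c"
    using z by auto
  then show "{x \<in> space (tree_borel \<zeta>). tree_dist \<zeta> z x < c} \<in> sets (tree_borel \<zeta>)"
    by (simp add: sets_tree_borel_open)
qed

lemma height_measurable [measurable]: "height \<in> borel_measurable (tree_borel \<zeta>)"
  using tree_dist_measurable[OF root_in] by (simp add: height_def[abs_def])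

lemma descendants_measurable:
  assumes z: "z \<in> tree \<zeta>"
  shows "Measurable.pred (tree_borel \<zeta>) (ancestor z)"
proof -
  note tree_dist_measurable[OF z, measurable]
  have "Measurable.pred (tree_borel \<zeta>) (\<lambda>x. height z + tree_dist \<zeta> z x = height x)"
    by measurable
  then show ?thesis
    using z by (subst measurable_cong[where g = "\<lambda>x. height z + tree_dist \<zeta> z x = height x"])
      (auto simp: ancestor_iff_dist)
qed

lemma sets_branch: "x \<in> tree \<zeta> \<Longrightarrow> branch x \<in> sets (tree_borel \<zeta>)"
proof -
  assume x: "x \<in> tree \<zeta>"
  note tree_dist_measurable[OF x, measurable]
  have "{w \<in> space (tree_borel \<zeta>). height w + tree_dist \<zeta> x w = height x} \<in> sets (tree_borel \<zeta>)"
    by measurable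
  also have "{w \<in> space (tree_borel \<zeta>). height w + tree_dist \<zeta> x w = height x} = branch x"
    using x by (auto simp: branch_def ancestor_iff_dist commute)
  finally show ?thesis .
qed

lemma sets_tree_singleton: "x \<in> tree \<zeta> \<Longrightarrow> {x} \<in> sets (tree_borel \<zeta>)"
proof -
  assume x: "x \<in> tree \<zeta>"
  note tree_dist_measurable[OF x, measurable]
  have "{w \<in> space (tree_borel \<zeta>). tree_dist \<zeta> x w = 0} \<in> sets (tree_borel \<zeta>)"
    by measurable
  also have "{w \<in> space (tree_borel \<zeta>). tree_dist \<zeta> x w = 0} = {x}"
    using x by auto
  finally show ?thesis .
qed

lemma meet_exists:
  assumes "x \<in> tree \<zeta>" "y \<in> tree \<zeta>"
  shows "\<exists>w. ancestor w x \<and> ancestor w y \<and> height w = meet_height x y"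
proof -
  obtain w where "ancestor w x" "height w = meet_height x y"
    using ancestor_at_height[of x "meet_height x y"] meet_height_nonneg meet_height_le assms by blast
  then show ?thesis using ancestor_both_iff[of w x y] assms by auto
qed

text \<open>Only countably many candidates for common ancestors have to be tested, so meet heights are jointly
  measurable with respect to the product of the Borel \<open>\<sigma>\<close>-algebras.\<close>
lemma meet_height_eq_SUP:
  assumes x: "x \<in> tree \<zeta>" and y: "y \<in> tree \<zeta>"
  shows "ennreal (meet_height x y) =
    (SUP z\<in>dense_points. if ancestor z x \<and> ancestor z y then ennreal (height z) else 0)"
proof (rule antisym)
  show "(SUP z\<in>dense_points. if ancestor z x \<and> ancestor z y then ennreal (height z) else 0)
      \<le> ennreal (meet_height x y)"
    using ancestor_both_iff[of _ x y] y by (intro SUP_least) (auto intro: ennreal_leI)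
  show "ennreal (meet_height x y) \<le>
      (SUP z\<in>dense_points. if ancestor z x \<and> ancestor z y then ennreal (height z) else 0)"
  proof (rule dense_le)
    fix c assume c: "c < ennreal (meet_height x y)"
    then obtain c' where c': "c = ennreal c'" "0 \<le> c'"
      by (cases c) auto
    then have less: "c' < meet_height x y" using c by (simp add: ennreal_less_iff)
    obtain w where w: "ancestor w x" "ancestor w y" "height w = meet_height x y"
      using meet_exists[OF x y] by blast
    obtain a where a: "ancestor a w" "height a = c'"
      using ancestor_at_height[of w c'] w c' less by (auto dest: ancestorD)
    then obtain z where z: "z \<in> dense_points" "ancestor a z" "ancestor z w"
      using dense_points_between[of a w] w less by force
    have "c \<le> ennreal (height z)"
      using ancestor_height_le[OF z(2)] a c' by (simp add: ennreal_leI)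
    also have "\<dots> = (if ancestor z x \<and> ancestor z y then ennreal (height z) else 0)"
      using z w by (auto intro: ancestor_trans)
    also have "\<dots> \<le> (SUP z\<in>dense_points. if ancestor z x \<and> ancestor z y then ennreal (height z) else 0)"
      using z(1) by (rule SUP_upper)
    finally show "c \<le> (SUP z\<in>dense_points. if ancestor z x \<and> ancestor z y then ennreal (height z) else 0)" .
  qed
qed

end

section \<open>Length of spanned subtrees\<close>

locale measured_tree = coded_tree \<zeta> \<sigma> for \<zeta> \<sigma> +
  fixes L :: "real set measure"
  assumes length_measure: "length_measure \<zeta> L"
begin

lemma sets_L [measurable_cong]: "sets L = sets (tree_borel \<zeta>)"
  using length_measure by (simp add: length_measure_def)

lemma space_L [simp]: "space L = tree \<zeta>"
  using sets_eq_imp_space_eq[OF sets_L] by simp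

lemma emeasure_branch: "x \<in> tree \<zeta> \<Longrightarrow> emeasure L (branch x) = ennreal (height x)"
  using length_measure by (simp add: length_measure_def branch_def height_def flip: geodesic_root)

definition spanned :: "(nat \<Rightarrow> real set) \<Rightarrow> nat \<Rightarrow> real set set" where
  "spanned x n = (\<Union>j\<in>{1..n}. branch (x j))"

lemma spanned_subtree_eq_spanned:
  "x \<in> {1..n} \<rightarrow> tree \<zeta> \<Longrightarrow> spanned_subtree \<zeta> x n = spanned x n"
  by (auto simp: spanned_subtree_def spanned_def geodesic_root branch_def Pi_iff)

lemma spanned_0 [simp]: "spanned x 0 = {}"
  by (simp add: spanned_def)

lemma spanned_Suc: "spanned x (Suc n) = spanned x n \<union> branch (x (Suc n))"
proof -
  have "{1..Suc n} = insert (Suc n) {1..n}" by auto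
  then show ?thesis by (simp only: spanned_def UN_insert Un_commute)
qed

lemma sets_spanned:
  "x \<in> {1..n} \<rightarrow> tree \<zeta> \<Longrightarrow> spanned x n \<in> sets L"
  by (auto simp: spanned_def sets_L Pi_iff intro!: sets.finite_UN sets_branch)

lemma sets_branch_L: "x \<in> tree \<zeta> \<Longrightarrow> branch x \<in> sets L"
  by (simp add: sets_L sets_branch)

lemma emeasure_spanned_Suc:
  assumes "x \<in> {1..Suc n} \<rightarrow> tree \<zeta>"
  shows "emeasure L (spanned x (Suc n)) = emeasure L (spanned x n) + emeasure L (branch (x (Suc n)) - spanned x n)"
proof -
  have "emeasure L (spanned x n \<union> (branch (x (Suc n)) - spanned x n)) =
      emeasure L (spanned x n) + emeasure L (branch (x (Suc n)) - spanned x n)"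
    using assms by (intro plus_emeasure[symmetric] sets.Diff sets_spanned sets_branch_L) auto
  then show ?thesis by (simp add: spanned_Suc)
qed

lemma emeasure_spanned_finite:
  assumes "x \<in> {1..n} \<rightarrow> tree \<zeta>"
  shows "emeasure L (spanned x n) < \<infinity>"
proof -
  have "emeasure L (spanned x n) \<le> (\<Sum>j=1..n. emeasure L (branch (x j)))"
    unfolding spanned_def using assms
    by (intro emeasure_subadditive_finite) (auto simp: sets_branch_L Pi_iff)
  also have "\<dots> = (\<Sum>j=1..n. ennreal (height (x j)))"
    using assms by (intro sum.cong emeasure_branch) auto
  also have "\<dots> < \<infinity>" by simp
  finally show ?thesis .
qed

text \<open>The intersections of one branch with others are nested, so their union is the largest of them,
  which ends at the highest meet.\<close>
lemma emeasure_branch_Int_spanned: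
  assumes x: "x \<in> {1..n} \<rightarrow> tree \<zeta>" and y: "y \<in> tree \<zeta>"
  shows "emeasure L (branch y \<inter> spanned x n) = (SUP j\<in>{1..n}. ennreal (meet_height y (x j)))"
proof (cases "n = 0")
  case True
  then show ?thesis by (simp add: bot_ennreal)
next
  case False
  define m where "m = Max ((\<lambda>j. meet_height y (x j)) ` {1..n})"
  have "m \<in> (\<lambda>j. meet_height y (x j)) ` {1..n}"
    unfolding m_def using False by (intro Max_in) auto
  then obtain j where j: "j \<in> {1..n}" "m = meet_height y (x j)" by blast
  have le: "meet_height y (x i) \<le> meet_height y (x j)" if "i \<in> {1..n}" for i
    using that unfolding j(2)[symmetric] m_def by (intro Max_ge) auto
  obtain z where z: "ancestor z y" "ancestor z (x j)" "height z = meet_height y (x j)"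
    using meet_exists[OF y, of "x j"] x j(1) by blast
  have "branch y \<inter> spanned x n = branch z"
  proof
    show "branch z \<subseteq> branch y \<inter> spanned x n"
      using branch_mono[OF z(1)] branch_mono[OF z(2)] j(1) by (auto simp: spanned_def)
    show "branch y \<inter> spanned x n \<subseteq> branch z"
    proof
      fix w assume "w \<in> branch y \<inter> spanned x n"
      then obtain i where i: "i \<in> {1..n}" "ancestor w y" "ancestor w (x i)"
        by (auto simp: spanned_def branch_def)
      then have "height w \<le> height z"
        using ancestor_both_iff[OF i(2) ancestorD(2)[OF i(3)]] le[OF i(1)] z(3) by simp
      then show "w \<in> branch z"
        using i(2) by (simp add: branch_below[OF z(1)]) (simp add: branch_def)
    qed
  qed
  then have "emeasure L (branch y \<inter> spanned x n) = ennreal (meet_height y (x j))"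
    using z by (simp add: emeasure_branch ancestorD)
  also have "\<dots> = (SUP j\<in>{1..n}. ennreal (meet_height y (x j)))"
    using j(1) le by (intro antisym SUP_upper SUP_least ennreal_leI) auto
  finally show ?thesis .
qed

lemma emeasure_branch_diff_spanned:
  assumes x: "x \<in> {1..n} \<rightarrow> tree \<zeta>" and y: "y \<in> tree \<zeta>"
  shows "emeasure L (branch y - spanned x n) =
    ennreal (height y) - (SUP j\<in>{1..n}. ennreal (meet_height y (x j)))"
proof -
  have "branch y - spanned x n = branch y - (branch y \<inter> spanned x n)" by blast
  moreover have "emeasure L (branch y \<inter> spanned x n) \<noteq> \<infinity>"
    using emeasure_mono[of "branch y \<inter> spanned x n" "branch y" L] sets_branch_L[OF y]
    by (auto simp: emeasure_branch[OF y] top_unique)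
  ultimately show ?thesis
    using x y emeasure_Diff[of L "branch y \<inter> spanned x n" "branch y"] sets_spanned[OF x] sets_branch_L[OF y]
    by (auto simp: emeasure_branch emeasure_branch_Int_spanned)
qed

lemma meet_height_measurable:
  assumes "i \<in> I" "j \<in> I"
  shows "(\<lambda>x. ennreal (meet_height (x i) (x j))) \<in> borel_measurable (PiM I (\<lambda>_. tree_borel \<zeta>))"
proof -
  have *: "Measurable.pred (PiM I (\<lambda>_. tree_borel \<zeta>)) (\<lambda>x. ancestor z (x k))"
    if "k \<in> I" "z \<in> dense_points" for k z
    using that dense_points_subset
    by (intro measurable_compose[OF measurable_component_singleton[of k I] descendants_measurable[of z]]) auto
  have "(\<lambda>x. SUP z\<in>dense_points. if ancestor z (x i) \<and> ancestor z (x j) then ennreal (height z) else 0)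
      \<in> borel_measurable (PiM I (\<lambda>_. tree_borel \<zeta>))"
    using countable_dense_points * assms by (intro borel_measurable_SUP measurable_If pred_intros_logic) auto
  then show ?thesis
  proof (rule measurable_cong[THEN iffD2, rotated])
    fix x assume "x \<in> space (PiM I (\<lambda>_. tree_borel \<zeta>))"
    then show "ennreal (meet_height (x i) (x j)) =
        (SUP z\<in>dense_points. if ancestor z (x i) \<and> ancestor z (x j) then ennreal (height z) else 0)"
      using assms by (intro meet_height_eq_SUP) (auto simp: space_PiM)
  qed
qed

text \<open>Adding the \<open>(n + 1)\<close>-st point lengthens the subtree by its height minus the height at which its branch
  leaves the subtree, and the latter is a maximum of meet heights.\<close>
lemma emeasure_spanned_measurable:
  assumes "n \<le> r"
  shows "(\<lambda>x. emeasure L (spanned x n)) \<in> borel_measurable (PiM {1..r} (\<lambda>_. tree_borel \<zeta>))"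
  using assms
proof (induction n)
  case (Suc n)
  let ?P = "PiM {1..r} (\<lambda>_. tree_borel \<zeta>)"
  have "(\<lambda>x. SUP j\<in>{1..n}. ennreal (meet_height (x (Suc n)) (x j))) \<in> borel_measurable ?P"
    using Suc.prems by (intro borel_measurable_SUP meet_height_measurable) auto
  moreover have "(\<lambda>x. ennreal (height (x (Suc n)))) \<in> borel_measurable ?P"
    using Suc.prems
    by (intro measurable_compose[OF measurable_component_singleton[of "Suc n"]] measurable_compose[OF height_measurable] measurable_ennreal) auto
  ultimately have "(\<lambda>x. emeasure L (spanned x n) + (ennreal (height (x (Suc n))) -
      (SUP j\<in>{1..n}. ennreal (meet_height (x (Suc n)) (x j))))) \<in> borel_measurable ?P"
    using Suc by (intro borel_measurable_add borel_measurable_minus_ennreal) auto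
  moreover have "emeasure L (spanned x (Suc n)) = emeasure L (spanned x n) + (ennreal (height (x (Suc n))) -
      (SUP j\<in>{1..n}. ennreal (meet_height (x (Suc n)) (x j))))" if "x \<in> space ?P" for x
  proof -
    have "x j \<in> tree \<zeta>" if "j \<in> {1..r}" for j
      using \<open>x \<in> space ?P\<close> that by (auto simp: space_PiM)
    then show ?thesis using Suc.prems
      by (subst emeasure_spanned_Suc) (auto simp: emeasure_branch_diff_spanned)
  qed
  ultimately show ?case by (subst measurable_cong) auto
qed simp

definition spanned_length :: "(nat \<Rightarrow> real set) \<Rightarrow> nat \<Rightarrow> real" where
  "spanned_length x n = measure L (spanned x n)"

lemma emeasure_spanned:
  assumes "x \<in> {1..n} \<rightarrow> tree \<zeta>"
  shows "emeasure L (spanned x n) = ennreal (spanned_length x n)"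
  unfolding spanned_length_def
  using emeasure_spanned_finite[OF assms] by (intro emeasure_eq_ennreal_measure) auto

end

section \<open>Staircase regions of the mark space\<close>

definition mark_intensity :: "real \<Rightarrow> real set measure \<Rightarrow> (real set \<times> real) measure" where
  "mark_intensity c L = scale_measure (ennreal c) (L \<Otimes>\<^sub>M restrict_space lborel {0..})"

context measured_tree
begin

sublocale marks: sigma_finite_measure "restrict_space lborel {0::real..}"
  by (intro sigma_finite_measure_restrict_space) (auto simp: lborel.sigma_finite_measure_axioms)

lemma sets_mark_intensity: "sets (mark_intensity c L) = sets (L \<Otimes>\<^sub>M restrict_space lborel {0..})"
  by (simp add: mark_intensity_def)

lemma sets_mark_intensity_Times:
  "A \<in> sets L \<Longrightarrow> A \<times> {0..q} \<in> sets (mark_intensity c L)"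
  unfolding sets_mark_intensity
  by (rule pair_measureI) (auto simp: sets_restrict_space_iff)

lemma emeasure_mark_intensity_Times:
  assumes "A \<in> sets L" "0 \<le> q"
  shows "emeasure (mark_intensity c L) (A \<times> {0..q}) = ennreal c * (emeasure L A * ennreal q)"
proof -
  have "emeasure (restrict_space lborel {0..}) {0..q} = ennreal q"
    using assms by (subst emeasure_restrict_space) auto
  moreover have "{0..q} \<in> sets (restrict_space lborel {0..})"
    by (auto simp: sets_restrict_space_iff)
  ultimately show ?thesis
    using assms by (simp add: mark_intensity_def emeasure_scale_measure marks.emeasure_pair_measure_Times)
qed

definition staircase :: "(nat \<Rightarrow> real set) \<Rightarrow> (nat \<Rightarrow> real) \<Rightarrow> nat \<Rightarrow> (real set \<times> real) set" where
  "staircase x q n = (\<Union>i\<in>{1..n}. branch (x i) \<times> {0..q i})"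

lemma sets_staircase:
  "x \<in> {1..n} \<rightarrow> tree \<zeta> \<Longrightarrow> staircase x q n \<in> sets (mark_intensity c L)"
  unfolding staircase_def by (intro sets.finite_UN sets_mark_intensity_Times sets_branch_L) auto

text \<open>The part of the last branch that belongs to the earlier subtree lies in a branch that is
  covered up to a later time; only the new part adds a rectangle.\<close>
lemma emeasure_staircase:
  assumes "x \<in> {1..n} \<rightarrow> tree \<zeta>" "\<And>j. j \<in> {1..n} \<Longrightarrow> 0 \<le> q j"
    and "\<And>i j. 1 \<le> i \<Longrightarrow> i < j \<Longrightarrow> j \<le> n \<Longrightarrow> q j \<le> q i"
  shows "emeasure (mark_intensity c L) (staircase x q n) =
    ennreal c * (\<Sum>i=1..n. emeasure L (branch (x i) - spanned x (i - 1)) * ennreal (q i))"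
  using assms
proof (induction n)
  case 0
  then show ?case by (simp add: staircase_def)
next
  case (Suc n)
  let ?A = "branch (x (Suc n)) - spanned x n"
  have A: "?A \<in> sets L" using Suc.prems by (intro sets.Diff sets_branch_L sets_spanned) auto
  have "staircase x q (Suc n) = staircase x q n \<union> ?A \<times> {0..q (Suc n)}"
  proof
    show "staircase x q n \<union> ?A \<times> {0..q (Suc n)} \<subseteq> staircase x q (Suc n)"
      by (force simp: staircase_def)
    show "staircase x q (Suc n) \<subseteq> staircase x q n \<union> ?A \<times> {0..q (Suc n)}"
    proof
      fix p assume "p \<in> staircase x q (Suc n)"
      then obtain i w t where i: "p = (w, t)" "i \<in> {1..Suc n}" "w \<in> branch (x i)" "t \<in> {0..q i}"
        by (auto simp: staircase_def)
      show "p \<in> staircase x q n \<union> ?A \<times> {0..q (Suc n)}"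
      proof (cases "w \<in> spanned x n")
        case True
        then obtain j where j: "j \<in> {1..n}" "w \<in> branch (x j)" by (auto simp: spanned_def)
        show ?thesis
        proof (cases "i = Suc n")
          case True
          then have "q i \<le> q j" using Suc.prems(3)[of j i] j by auto
          then show ?thesis using i j by (force simp: staircase_def)
        next
          case False
          then have "i \<in> {1..n}" using i by auto
          then show ?thesis using i by (force simp: staircase_def)
        qed
      next
        case False
        then have "i = Suc n" using i by (force simp: spanned_def)
        then show ?thesis using i False by auto
      qed
    qed
  qed
  moreover have "staircase x q n \<inter> ?A \<times> {0..q (Suc n)} = {}"
    by (auto simp: staircase_def spanned_def)
  moreover have "staircase x q n \<in> sets (mark_intensity c L)"
    using Suc.prems by (intro sets_staircase) auto
  ultimately have "emeasure (mark_intensity c L) (staircase x q (Suc n)) =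
      emeasure (mark_intensity c L) (staircase x q n) +
      emeasure (mark_intensity c L) (?A \<times> {0..q (Suc n)})"
    using sets_mark_intensity_Times[OF A] by (simp add: plus_emeasure)
  also have "emeasure (mark_intensity c L) (staircase x q n) =
      ennreal c * (\<Sum>i=1..n. emeasure L (branch (x i) - spanned x (i - 1)) * ennreal (q i))"
    using Suc.prems by (intro Suc.IH) auto
  also have "emeasure (mark_intensity c L) (?A \<times> {0..q (Suc n)}) =
      ennreal c * (emeasure L ?A * ennreal (q (Suc n)))"
    using A Suc.prems by (intro emeasure_mark_intensity_Times) auto
  finally show ?case by (simp add: distrib_left)
qed

lemma emeasure_staircase_length:
  assumes x: "x \<in> {1..n} \<rightarrow> tree \<zeta>" and q: "\<And>j. j \<in> {1..n} \<Longrightarrow> 0 \<le> q j"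
    and mono: "\<And>i j. 1 \<le> i \<Longrightarrow> i < j \<Longrightarrow> j \<le> n \<Longrightarrow> q j \<le> q i" and c: "0 \<le> c"
  shows "emeasure (mark_intensity c L) (staircase x q n) =
    ennreal (\<Sum>i=1..n. c * (spanned_length x i - spanned_length x (i - 1)) * q i)"
    and "0 \<le> (\<Sum>i=1..n. c * (spanned_length x i - spanned_length x (i - 1)) * q i)"
proof -
  have inc: "emeasure L (branch (x i) - spanned x (i - 1)) = ennreal (spanned_length x i - spanned_length x (i - 1))"
    "0 \<le> spanned_length x i - spanned_length x (i - 1)" if i: "i \<in> {1..n}" for i
  proof -
    obtain k where k: "i = Suc k" using i by (cases i) auto
    have xk: "x \<in> {1..Suc k} \<rightarrow> tree \<zeta>" "x \<in> {1..k} \<rightarrow> tree \<zeta>" using i k x by auto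
    have "emeasure L (branch (x i) - spanned x k) \<le> ennreal (height (x i))"
      using emeasure_mono[of "branch (x i) - spanned x k" "branch (x i)" L] x i
      by (auto simp: sets_branch_L emeasure_branch Pi_iff)
    then obtain d where d: "emeasure L (branch (x i) - spanned x k) = ennreal d" "0 \<le> d"
      by (cases "emeasure L (branch (x i) - spanned x k)") (auto simp: top_unique)
    have "ennreal (spanned_length x i) = ennreal (spanned_length x k) + ennreal d"
      using emeasure_spanned_Suc[OF xk(1)] d k xk by (simp add: emeasure_spanned)
    then have "spanned_length x i = spanned_length x k + d"
      using d by (simp add: spanned_length_def flip: ennreal_plus)
    then show "emeasure L (branch (x i) - spanned x (i - 1)) = ennreal (spanned_length x i - spanned_length x (i - 1))"
      "0 \<le> spanned_length x i - spanned_length x (i - 1)"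
      using d k by auto
  qed
  have nonneg: "0 \<le> c * (spanned_length x i - spanned_length x (i - 1)) * q i" if "i \<in> {1..n}" for i
    using inc(2)[OF that] q[OF that] c by simp
  then show "0 \<le> (\<Sum>i=1..n. c * (spanned_length x i - spanned_length x (i - 1)) * q i)"
    by (rule sum_nonneg)
  have "emeasure (mark_intensity c L) (staircase x q n) =
      ennreal c * (\<Sum>i=1..n. emeasure L (branch (x i) - spanned x (i - 1)) * ennreal (q i))"
    using x q mono by (rule emeasure_staircase)
  also have "\<dots> = (\<Sum>i=1..n. ennreal (c * (spanned_length x i - spanned_length x (i - 1)) * q i))"
    unfolding sum_distrib_left
    by (intro sum.cong refl) (use inc q c in \<open>simp add: ennreal_mult mult.assoc\<close>)
  also have "\<dots> = ennreal (\<Sum>i=1..n. c * (spanned_length x i - spanned_length x (i - 1)) * q i)"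
    using nonneg by (rule sum_ennreal)
  finally show "emeasure (mark_intensity c L) (staircase x q n) =
    ennreal (\<Sum>i=1..n. c * (spanned_length x i - spanned_length x (i - 1)) * q i)" .
qed

end

section \<open>Void probabilities of Poisson point measures\<close>

text \<open>The positions of the points. Only the sets without points matter here, so multiplicities are
  forgotten.\<close>
definition point_support :: "'a measure \<Rightarrow> 'a measure \<Rightarrow> 'a set \<Rightarrow> bool" where
  "point_support S N Q \<longleftrightarrow>
     countable Q \<and> Q \<subseteq> space S \<and> (\<forall>A\<in>sets S. emeasure N A = 0 \<longleftrightarrow> Q \<inter> A = {})"

lemma point_support_exists:
  assumes "point_measure_on S N"
  shows "\<exists>Q. point_support S N Q"
proof -
  obtain I :: "nat set" and a where a: "a \<in> I \<rightarrow> space S" "N = distr (count_space I) S a"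
    using assms by (auto simp: point_measure_on_def)
  have "emeasure N A = 0 \<longleftrightarrow> a ` I \<inter> A = {}" if "A \<in> sets S" for A
  proof -
    have "emeasure N A = emeasure (count_space I) (a -` A \<inter> I)"
      using a that by (simp add: emeasure_distr)
    then show ?thesis by (auto simp: emeasure_count_space_eq_0)
  qed
  then show ?thesis using a by (intro exI[of _ "a ` I"]) (auto simp: point_support_def)
qed

lemma poisson_void_probability:
  assumes "prob_space P" "has_poisson_law P X (ennreal c)" "0 \<le> c"
  shows "emeasure P {\<omega> \<in> space P. X \<omega> = 0} = ennreal (exp (- c))"
proof -
  interpret prob_space P by fact
  have [measurable]: "X \<in> borel_measurable P" using assms by (simp add: has_poisson_law_def)
  show ?thesis
  proof (cases "c = 0")
    case True
    then have "AE \<omega> in P. X \<omega> = 0" using assms by (simp add: has_poisson_law_def)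
    then have "emeasure P {\<omega> \<in> space P. X \<omega> = 0} = 1"
      by (intro emeasure_eq_1_AE) auto
    then show ?thesis using True by simp
  next
    case False
    then have c: "0 < c" using assms by simp
    then have D: "distr P borel X = distr (measure_pmf (poisson_pmf c)) borel of_nat"
      using assms by (simp add: has_poisson_law_def)
    have "{\<omega> \<in> space P. X \<omega> = 0} = X -` {0} \<inter> space P" by auto
    then have "emeasure P {\<omega> \<in> space P. X \<omega> = 0} = emeasure (distr P borel X) {0}"
      by (simp add: emeasure_distr)
    also have "\<dots> = emeasure (measure_pmf (poisson_pmf c)) {0}"
      unfolding D by (subst emeasure_distr) (auto intro!: arg_cong2[where f = emeasure])
    also have "\<dots> = ennreal (exp (- c))"
      using c by (simp add: emeasure_pmf_single)
    finally show ?thesis .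
  qed
qed

section \<open>Mark times\<close>

context measured_tree
begin

abbreviation "mass \<equiv> mass_measure \<zeta> \<sigma>"

lemma sets_mass [measurable_cong]: "sets mass = sets (tree_borel \<zeta>)"
  by (simp add: mass_measure_def)

lemma space_mass [simp]: "space mass = tree \<zeta>"
  using sets_eq_imp_space_eq[OF sets_mass] by simp

sublocale mass: finite_measure mass
proof -
  have "finite_measure (restrict_space lborel {0..\<sigma>})"
    using sigma_nonneg by (intro finite_measureI) (simp add: emeasure_restrict_space space_restrict_space)
  then show "finite_measure mass"
    unfolding mass_measure_def
    by (rule finite_measure.finite_measure_distr) (rule tree_proj_measurable[OF code_nonneg code_continuous])
qed

lemma space_mark_intensity: "space (mark_intensity c L) = tree \<zeta> \<times> {0..}"
  using sets_eq_imp_space_eq[OF sets_mark_intensity]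
  by (simp add: space_pair_measure space_restrict_space)

text \<open>A point is contained in the last piece of length \<open>e\<close> of its branch, for every \<open>e > 0\<close>.\<close>
lemma emeasure_L_singleton:
  assumes x: "x \<in> tree \<zeta>"
  shows "emeasure L {x} = 0"
proof -
  have "emeasure L {x} \<le> 0"
  proof (rule ennreal_le_epsilon)
    fix e :: real assume e: "0 < e"
    show "emeasure L {x} \<le> 0 + ennreal e"
    proof (cases "height x \<le> e")
      case True
      have "emeasure L {x} \<le> emeasure L (branch x)"
        by (intro emeasure_mono sets_branch_L x) (auto simp: branch_def ancestor_refl x)
      then show ?thesis
        using True by (auto simp: emeasure_branch x intro: order_trans ennreal_leI)
    next
      case False
      then obtain z where z: "ancestor z x" "height z = height x - e"
        using ancestor_at_height[OF x, of "height x - e"] e by auto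
      have zin: "z \<in> tree \<zeta>" using z by (auto dest: ancestorD)
      have "emeasure L {x} \<le> emeasure L (branch x - branch z)"
        using e z(2) ancestor_height_le[of x z] by (intro emeasure_mono sets.Diff sets_branch_L x zin)
          (auto simp: branch_def ancestor_refl x)
      also have "\<dots> = emeasure L (branch x) - emeasure L (branch z)"
        using x zin branch_mono[OF z(1)]
        by (intro emeasure_Diff) (auto simp: emeasure_branch sets_branch_L)
      also have "\<dots> = ennreal e"
        using e z False by (simp add: emeasure_branch x zin ennreal_minus)
      finally show ?thesis by simp
    qed
  qed
  then show ?thesis by simp
qed

lemma mark_time_branch:
  assumes "x \<in> tree \<zeta>"
  shows "mark_time \<zeta> N x = Inf (ennreal ` {q. 0 < q \<and> emeasure N (branch x \<times> {0..q}) \<noteq> 0})"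
  using assms by (simp add: mark_time_def geodesic_root branch_def zero_less_iff_neq_zero)

text \<open>Atoms of the mass measure, which arise from flat parts of \<open>\<zeta>\<close>, are included so that the exceptional
  set of \<open>sampled_mark_time_eq\<close> is always null.\<close>
definition sampling_points :: "real set set" where
  "sampling_points = dense_points \<union> {x \<in> tree \<zeta>. measure mass {x} \<noteq> 0}"

definition sampled_mark_time :: "(real set \<times> real) measure \<Rightarrow> real set \<Rightarrow> ennreal" where
  "sampled_mark_time N x =
     (INF z\<in>sampling_points. if ancestor z x then mark_time \<zeta> N z else \<infinity>)"

lemma countable_sampling_points: "countable sampling_points"
  unfolding sampling_points_def
  using countable_dense_points mass.countable_support
  by (auto intro: countable_subset[of _ "{x. measure mass {x} \<noteq> 0}"])

lemma sampling_points_subset: "sampling_points \<subseteq> tree \<zeta>"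
  using dense_points_subset by (auto simp: sampling_points_def)

context
  fixes c :: real and N :: "(real set \<times> real) measure" and Q
  assumes Q: "point_support (mark_intensity c L) N Q"
begin

lemma void_iff: "A \<in> sets (mark_intensity c L) \<Longrightarrow> emeasure N A = 0 \<longleftrightarrow> Q \<inter> A = {}"
  using Q by (simp add: point_support_def)

lemma support_subset: "Q \<subseteq> tree \<zeta> \<times> {0..}"
  using Q by (simp add: point_support_def space_mark_intensity)

lemma void_branch_iff:
  "x \<in> tree \<zeta> \<Longrightarrow> emeasure N (branch x \<times> {0..q}) = 0 \<longleftrightarrow> Q \<inter> branch x \<times> {0..q} = {}"
  by (intro void_iff sets_mark_intensity_Times sets_branch_L)

lemma void_staircase_iff:
  assumes "x \<in> {1..n} \<rightarrow> tree \<zeta>"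
  shows "emeasure N (staircase x q n) = 0 \<longleftrightarrow> (\<forall>i\<in>{1..n}. emeasure N (branch (x i) \<times> {0..q i}) = 0)"
proof -
  have "emeasure N (staircase x q n) = 0 \<longleftrightarrow> Q \<inter> staircase x q n = {}"
    using assms by (intro void_iff sets_staircase)
  also have "\<dots> \<longleftrightarrow> (\<forall>i\<in>{1..n}. Q \<inter> branch (x i) \<times> {0..q i} = {})"
    unfolding staircase_def by blast
  also have "\<dots> \<longleftrightarrow> (\<forall>i\<in>{1..n}. emeasure N (branch (x i) \<times> {0..q i}) = 0)"
  proof (rule ball_cong[OF refl])
    fix i assume "i \<in> {1..n}"
    then have "x i \<in> tree \<zeta>" using assms by auto
    then show "Q \<inter> branch (x i) \<times> {0..q i} = {} \<longleftrightarrow> emeasure N (branch (x i) \<times> {0..q i}) = 0"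
      by (simp only: void_branch_iff)
  qed
  finally show ?thesis .
qed

lemma mark_time_le:
  assumes "x \<in> tree \<zeta>" "0 < q" "emeasure N (branch x \<times> {0..q}) \<noteq> 0"
  shows "mark_time \<zeta> N x \<le> ennreal q"
  unfolding mark_time_branch[OF assms(1)] using assms by (intro Inf_lower) auto

lemma mark_time_ge:
  assumes "x \<in> tree \<zeta>" "emeasure N (branch x \<times> {0..q}) = 0"
  shows "ennreal q \<le> mark_time \<zeta> N x"
  unfolding mark_time_branch[OF assms(1)]
proof (rule Inf_greatest, safe)
  fix q' assume "emeasure N (branch x \<times> {0..q'}) \<noteq> 0"
  then have "q \<le> q'"
    using assms by (rule_tac ccontr) (force simp: void_branch_iff)
  then show "ennreal q \<le> ennreal q'" by (rule ennreal_leI)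
qed

lemma mark_time_antimono:
  assumes "ancestor z x"
  shows "mark_time \<zeta> N x \<le> mark_time \<zeta> N z"
proof -
  have "{q. 0 < q \<and> emeasure N (branch z \<times> {0..q}) \<noteq> 0} \<subseteq> {q. 0 < q \<and> emeasure N (branch x \<times> {0..q}) \<noteq> 0}"
    using ancestorD[OF assms] branch_mono[OF assms] by (auto simp: void_branch_iff)
  then show ?thesis
    using ancestorD[OF assms] by (simp add: mark_time_branch Inf_superset_mono image_mono)
qed

text \<open>Voids are inherited by smaller times, so rational times suffice; this makes the mark time of a
  fixed point a random variable.\<close>
lemma mark_time_rational:
  assumes x: "x \<in> tree \<zeta>"
  shows "mark_time \<zeta> N x =
    (INF q\<in>\<rat> \<inter> {0<..}. if emeasure N (branch x \<times> {0..q}) = 0 then \<infinity> else ennreal q)"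
proof (rule antisym)
  show "mark_time \<zeta> N x \<le> (INF q\<in>\<rat> \<inter> {0<..}. if emeasure N (branch x \<times> {0..q}) = 0 then \<infinity> else ennreal q)"
    using mark_time_le[OF x] by (intro INF_greatest) auto
  show "(INF q\<in>\<rat> \<inter> {0<..}. if emeasure N (branch x \<times> {0..q}) = 0 then \<infinity> else ennreal q) \<le> mark_time \<zeta> N x"
    unfolding mark_time_branch[OF x]
  proof (rule Inf_greatest, safe)
    fix q :: real assume q: "0 < q" "emeasure N (branch x \<times> {0..q}) \<noteq> 0"
    show "(INF q\<in>\<rat> \<inter> {0<..}. if emeasure N (branch x \<times> {0..q}) = 0 then \<infinity> else ennreal q) \<le> ennreal q"
    proof (rule ennreal_le_epsilon)
      fix e :: real assume "0 < e"
      then obtain q' where q': "q' \<in> \<rat>" "q < q'" "q' < q + e"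
        using Rats_dense_in_real[of q "q + e"] by auto
      have "emeasure N (branch x \<times> {0..q'}) \<noteq> 0"
        using q q' x by (fastforce simp: void_branch_iff)
      then have "(INF q\<in>\<rat> \<inter> {0<..}. if emeasure N (branch x \<times> {0..q}) = 0 then \<infinity> else ennreal q) \<le> ennreal q'"
        using q q' by (intro INF_lower2[of q']) auto
      also have "\<dots> \<le> ennreal q + ennreal e"
        using q q' \<open>0 < e\<close> by (simp flip: ennreal_plus)
      finally show "(INF q\<in>\<rat> \<inter> {0<..}. if emeasure N (branch x \<times> {0..q}) = 0 then \<infinity> else ennreal q) \<le> ennreal q + ennreal e" .
    qed
  qed
qed

text \<open>A mark on the branch of \<open>x\<close> that does not sit at \<open>x\<close> itself is separated from \<open>x\<close> by one of the
  countably many sampling points, and is therefore seen by the mark time of that point.\<close>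
lemma sampled_mark_time_eq:
  assumes x: "x \<in> tree \<zeta>" and ok: "x \<in> sampling_points \<or> x \<notin> fst ` Q"
  shows "sampled_mark_time N x = mark_time \<zeta> N x"
proof (rule antisym)
  show "mark_time \<zeta> N x \<le> sampled_mark_time N x"
    unfolding sampled_mark_time_def by (intro INF_greatest) (auto intro: mark_time_antimono)
  show "sampled_mark_time N x \<le> mark_time \<zeta> N x"
  proof (cases "x \<in> sampling_points")
    case True
    then show ?thesis
      unfolding sampled_mark_time_def by (intro INF_lower2[of x]) (auto simp: ancestor_refl x)
  next
    case False
    show ?thesis
      unfolding mark_time_branch[OF x]
    proof (rule Inf_greatest, safe)
      fix q :: real assume q: "0 < q" "emeasure N (branch x \<times> {0..q}) \<noteq> 0"
      then have "Q \<inter> branch x \<times> {0..q} \<noteq> {}" using void_branch_iff[OF x] by blast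
      then obtain w t where w: "(w, t) \<in> Q" "w \<in> branch x" "t \<in> {0..q}" by blast
      have "w \<noteq> x" using False ok w by force
      then obtain z where z: "z \<in> dense_points" "ancestor w z" "ancestor z x"
        using dense_points_between[of w x] w by (auto simp: branch_def)
      have "emeasure N (branch z \<times> {0..q}) \<noteq> 0"
        using w z void_branch_iff[OF ancestorD(1)[OF z(3)]] by (auto simp: branch_def)
      then have "mark_time \<zeta> N z \<le> ennreal q"
        using q ancestorD[OF z(3)] by (intro mark_time_le) auto
      then show "sampled_mark_time N x \<le> ennreal q"
        unfolding sampled_mark_time_def using z
        by (intro INF_lower2[of z]) (auto simp: sampling_points_def)
    qed
  qed
qed

text \<open>Countably many points carry marks, and those among them outside the sampling points are not atoms of
  the mass measure.\<close>
lemma AE_sampled_mark_time_eq: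
  "AE x in mass. sampled_mark_time N x = mark_time \<zeta> N x"
proof (rule AE_I')
  have null: "{x} \<in> null_sets mass" if "x \<in> fst ` Q - sampling_points" for x
  proof -
    have x: "x \<in> tree \<zeta>" using that support_subset by force
    then have "emeasure mass {x} = 0"
      using that by (simp add: sampling_points_def mass.emeasure_eq_measure)
    then show ?thesis
      using sets_tree_singleton[OF x] unfolding null_sets_def sets_mass by blast
  qed
  have "(\<Union>x\<in>fst ` Q - sampling_points. {x}) \<in> null_sets mass"
    using Q null by (intro null_sets_UN') (auto simp: point_support_def)
  then show "fst ` Q - sampling_points \<in> null_sets mass" by simp
  show "{x \<in> space mass. sampled_mark_time N x \<noteq> mark_time \<zeta> N x} \<subseteq> fst ` Q - sampling_points"
    using sampled_mark_time_eq by auto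
qed

end

end

text \<open>The rate \<open>c\<close> stands for \<open>2 \<alpha>\<close>.\<close>
locale marked_tree = measured_tree \<zeta> \<sigma> L for \<zeta> \<sigma> L +
  fixes c :: real and P :: "'w measure" and M :: "'w \<Rightarrow> (real set \<times> real) measure"
  assumes rate_pos: "0 < c"
    and poisson: "poisson_point_measure P M (mark_intensity c L)"
begin

sublocale P: prob_space P
  using poisson by (simp add: poisson_point_measure_def)

lemma mark_law: "A \<in> sets (mark_intensity c L) \<Longrightarrow>
    has_poisson_law P (\<lambda>\<omega>. emeasure (M \<omega>) A) (emeasure (mark_intensity c L) A)"
  using poisson by (simp add: poisson_point_measure_def)

lemma mark_measurable: "A \<in> sets (mark_intensity c L) \<Longrightarrow> (\<lambda>\<omega>. emeasure (M \<omega>) A) \<in> borel_measurable P"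
  using mark_law by (simp add: has_poisson_law_def)

lemma mark_support: "\<omega> \<in> space P \<Longrightarrow> \<exists>Q. point_support (mark_intensity c L) (M \<omega>) Q"
  using poisson by (auto simp: poisson_point_measure_def intro: point_support_exists)

lemma mark_time_measurable:
  assumes x: "x \<in> tree \<zeta>"
  shows "(\<lambda>\<omega>. mark_time \<zeta> (M \<omega>) x) \<in> borel_measurable P"
proof (rule measurable_cong[THEN iffD2])
  show "mark_time \<zeta> (M \<omega>) x =
      (INF q\<in>\<rat> \<inter> {0<..}. if emeasure (M \<omega>) (branch x \<times> {0..q}) = 0 then \<infinity> else ennreal q)"
    if \<omega>: "\<omega> \<in> space P" for \<omega>
  proof -
    obtain Q where Q: "point_support (mark_intensity c L) (M \<omega>) Q"
      using mark_support[OF \<omega>] by blast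
    show ?thesis by (rule mark_time_rational[OF Q x])
  qed
  have [measurable]: "(\<lambda>\<omega>. emeasure (M \<omega>) (branch x \<times> {0..q})) \<in> borel_measurable P" for q
    by (intro mark_measurable sets_mark_intensity_Times sets_branch_L x)
  show "(\<lambda>\<omega>. INF q\<in>\<rat> \<inter> {0<..}. if emeasure (M \<omega>) (branch x \<times> {0..q}) = 0 then \<infinity> else ennreal q)
      \<in> borel_measurable P"
    using countable_rat by (intro borel_measurable_INF) auto
qed

lemma sampled_mark_time_measurable [measurable]:
  "(\<lambda>(\<omega>, x). sampled_mark_time (M \<omega>) x) \<in> borel_measurable (P \<Otimes>\<^sub>M mass)"
proof -
  have "(\<lambda>p. INF z\<in>sampling_points. if ancestor z (snd p) then mark_time \<zeta> (M (fst p)) z else \<infinity>)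
      \<in> borel_measurable (P \<Otimes>\<^sub>M mass)"
  proof (rule borel_measurable_INF[OF countable_sampling_points])
    fix z assume "z \<in> sampling_points"
    then have z: "z \<in> tree \<zeta>" using sampling_points_subset by auto
    note descendants_measurable[OF z, measurable] mark_time_measurable[OF z, measurable]
    show "(\<lambda>p. if ancestor z (snd p) then mark_time \<zeta> (M (fst p)) z else \<infinity>)
        \<in> borel_measurable (P \<Otimes>\<^sub>M mass)"
      by measurable
  qed
  then show ?thesis by (simp add: sampled_mark_time_def split_beta')
qed

lemma total_mark_time_eq:
  assumes \<omega>: "\<omega> \<in> space P"
  shows "total_mark_time \<zeta> \<sigma> (M \<omega>) = (\<integral>\<^sup>+x. sampled_mark_time (M \<omega>) x \<partial>mass)"
proof -
  obtain Q where "point_support (mark_intensity c L) (M \<omega>) Q"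
    using mark_support[OF \<omega>] by blast
  then have "AE x in mass. sampled_mark_time (M \<omega>) x = mark_time \<zeta> (M \<omega>) x"
    by (rule AE_sampled_mark_time_eq)
  then show ?thesis
    unfolding total_mark_time_def by (intro nn_integral_cong_AE) (auto elim: eventually_mono)
qed

text \<open>A single point has length zero, so almost surely no mark falls on it.\<close>
lemma AE_sampled_mark_time_eq_fixed:
  assumes x: "x \<in> tree \<zeta>"
  shows "AE \<omega> in P. sampled_mark_time (M \<omega>) x = mark_time \<zeta> (M \<omega>) x"
proof -
  have sx: "{x} \<times> {0..real n} \<in> sets (mark_intensity c L)" for n
    using x by (intro sets_mark_intensity_Times) (simp add: sets_L sets_tree_singleton)
  have "emeasure L {x} = 0" using x by (rule emeasure_L_singleton)
  then have "emeasure (mark_intensity c L) ({x} \<times> {0..real n}) = 0" for n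
    using x by (subst emeasure_mark_intensity_Times) (auto simp: sets_L sets_tree_singleton)
  then have "AE \<omega> in P. \<forall>n. emeasure (M \<omega>) ({x} \<times> {0..real n}) = 0"
    unfolding AE_all_countable using mark_law[OF sx] by (simp add: has_poisson_law_def)
  then show ?thesis
    using AE_space
  proof eventually_elim
    case (elim \<omega>)
    obtain Q where Q: "point_support (mark_intensity c L) (M \<omega>) Q"
      using mark_support[OF elim(2)] by blast
    have "x \<notin> fst ` Q"
    proof
      assume "x \<in> fst ` Q"
      then obtain t where t: "(x, t) \<in> Q" by auto
      then have "0 \<le> t" using support_subset[OF Q] by auto
      moreover obtain n where "t \<le> real n" using real_arch_simple by blast
      ultimately have "Q \<inter> {x} \<times> {0..real n} \<noteq> {}" using t by auto
      then show False using elim(1) void_iff[OF Q sx] by blast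
    qed
    then show ?case by (intro sampled_mark_time_eq[OF Q x]) simp
  qed
qed

end

section \<open>Moments of the total mark time\<close>

context marked_tree
begin

lemma void_staircase_probability:
  assumes x: "x \<in> {1..n} \<rightarrow> tree \<zeta>" and q: "\<And>j. j \<in> {1..n} \<Longrightarrow> 0 \<le> q j"
    and mono: "\<And>i j. 1 \<le> i \<Longrightarrow> i < j \<Longrightarrow> j \<le> n \<Longrightarrow> q j \<le> q i"
  shows "emeasure P {\<omega> \<in> space P. emeasure (M \<omega>) (staircase x q n) = 0} =
    ennreal (exp (- (\<Sum>i=1..n. c * (spanned_length x i - spanned_length x (i - 1)) * q i)))"
proof -
  have c: "0 \<le> c" using rate_pos by simp
  have "has_poisson_law P (\<lambda>\<omega>. emeasure (M \<omega>) (staircase x q n))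
      (ennreal (\<Sum>i=1..n. c * (spanned_length x i - spanned_length x (i - 1)) * q i))"
    using mark_law[OF sets_staircase[OF x, of q c]]
    by (simp only: emeasure_staircase_length(1)[of x n q c, OF x q mono c])
  then show ?thesis
    using emeasure_staircase_length(2)[of x n q c, OF x q mono c]
    by (intro poisson_void_probability P.prob_space_axioms)
qed

text \<open>Survival beyond the times \<open>q i\<close> forces the staircase over \<open>q\<close> to be void, and is forced by a void
  staircase over \<open>q + e\<close> for any \<open>e > 0\<close>. The two probabilities agree in the limit \<open>e \<rightarrow> 0\<close>.\<close>
lemma mark_time_survival_probability:
  assumes x: "x \<in> {1..n} \<rightarrow> tree \<zeta>" and q: "decreasing_above n 0 q"
  shows "emeasure P {\<omega> \<in> space P. \<forall>i\<in>{1..n}. ennreal (q i) < mark_time \<zeta> (M \<omega>) (x i)} =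
    ennreal (exp (- (\<Sum>i=1..n. c * (spanned_length x i - spanned_length x (i - 1)) * q i)))"
    (is "emeasure P ?E = ennreal (exp (- ?s q))")
proof (rule antisym)
  have q0: "0 < q j" if "j \<in> {1..n}" for j using q that by (auto simp: decreasing_above_def)
  have mono: "q j \<le> q i" if "1 \<le> i" "i < j" "j \<le> n" for i j
    using q that by (auto simp: decreasing_above_def intro!: less_imp_le)
  have xi: "x i \<in> tree \<zeta>" if "i \<in> {1..n}" for i using x that by auto
  have mt [measurable]: "(\<lambda>\<omega>. mark_time \<zeta> (M \<omega>) (x i)) \<in> borel_measurable P" if "i \<in> {1..n}" for i
    using that by (intro mark_time_measurable xi)
  have E [measurable]: "?E \<in> sets P" by measurable
  have stair [measurable]: "(\<lambda>\<omega>. emeasure (M \<omega>) (staircase x q' n)) \<in> borel_measurable P" for q'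
    by (intro mark_measurable sets_staircase x)
  have "?E \<subseteq> {\<omega> \<in> space P. emeasure (M \<omega>) (staircase x q n) = 0}"
  proof safe
    fix \<omega> assume \<omega>: "\<omega> \<in> space P" and less: "\<forall>i\<in>{1..n}. ennreal (q i) < mark_time \<zeta> (M \<omega>) (x i)"
    obtain Q where Q: "point_support (mark_intensity c L) (M \<omega>) Q"
      using mark_support[OF \<omega>] by blast
    have "emeasure (M \<omega>) (branch (x i) \<times> {0..q i}) = 0" if "i \<in> {1..n}" for i
      using mark_time_le[OF Q xi[OF that] q0[OF that]] less that by (auto simp: not_le[symmetric])
    then show "emeasure (M \<omega>) (staircase x q n) = 0"
      by (simp add: void_staircase_iff[OF Q x])
  qed
  then have "emeasure P ?E \<le> emeasure P {\<omega> \<in> space P. emeasure (M \<omega>) (staircase x q n) = 0}"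
    by (rule emeasure_mono) measurable
  also have "\<dots> = ennreal (exp (- ?s q))"
    using x q0 mono by (intro void_staircase_probability) (auto intro: less_imp_le)
  finally show "emeasure P ?E \<le> ennreal (exp (- ?s q))" .
  have lower: "ennreal (exp (- ?s (\<lambda>i. q i + e))) \<le> emeasure P ?E" if e: "0 < e" for e
  proof -
    have "ennreal (exp (- ?s (\<lambda>i. q i + e))) =
        emeasure P {\<omega> \<in> space P. emeasure (M \<omega>) (staircase x (\<lambda>i. q i + e) n) = 0}"
      using x q0 mono e by (intro void_staircase_probability[symmetric]) (auto intro: less_imp_le add_nonneg_nonneg)
    also have "\<dots> \<le> emeasure P ?E"
    proof (rule emeasure_mono[OF _ E], safe)
      fix \<omega> i assume \<omega>: "\<omega> \<in> space P" and void: "emeasure (M \<omega>) (staircase x (\<lambda>i. q i + e) n) = 0"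
        and i: "i \<in> {1..n}"
      obtain Q where Q: "point_support (mark_intensity c L) (M \<omega>) Q"
        using mark_support[OF \<omega>] by blast
      have "ennreal (q i) < ennreal (q i + e)" using q0[OF i] e by (simp add: ennreal_less_iff)
      also have "\<dots> \<le> mark_time \<zeta> (M \<omega>) (x i)"
        using void i by (intro mark_time_ge[OF Q xi]) (auto simp: void_staircase_iff[OF Q x])
      finally show "ennreal (q i) < mark_time \<zeta> (M \<omega>) (x i)" .
    qed
    finally show ?thesis .
  qed
  have "((\<lambda>e. ennreal (exp (- ?s (\<lambda>i. q i + e)))) \<longlongrightarrow> ennreal (exp (- ?s (\<lambda>i. q i + 0)))) (at_right 0)"
    by (intro tendsto_intros)
  then have "((\<lambda>e. ennreal (exp (- ?s (\<lambda>i. q i + e)))) \<longlongrightarrow> ennreal (exp (- ?s q))) (at_right 0)"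
    by simp
  moreover have "\<forall>\<^sub>F e in at_right 0. ennreal (exp (- ?s (\<lambda>i. q i + e))) \<le> emeasure P ?E"
    using eventually_at_right_less[of 0] by eventually_elim (rule lower)
  ultimately show "ennreal (exp (- ?s q)) \<le> emeasure P ?E"
    by (rule tendsto_upperbound) simp
qed

lemma sampled_mark_time_survival_probability:
  assumes x: "x \<in> {1..n} \<rightarrow> tree \<zeta>" and q: "decreasing_above n 0 q"
  shows "(\<integral>\<^sup>+\<omega>. (\<Prod>i=1..n. if ennreal (q i) < sampled_mark_time (M \<omega>) (x i) then 1 else 0) \<partial>P) =
    (\<Prod>i=1..n. ennreal (exp (- (c * spanned_length x i - c * spanned_length x (i - 1)) * q i)))"
proof -
  have xi: "x i \<in> tree \<zeta>" if "i \<in> {1..n}" for i using x that by auto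
  have [measurable]: "(\<lambda>\<omega>. mark_time \<zeta> (M \<omega>) (x i)) \<in> borel_measurable P" if "i \<in> {1..n}" for i
    using that by (intro mark_time_measurable xi)
  let ?E = "{\<omega> \<in> space P. \<forall>i\<in>{1..n}. ennreal (q i) < mark_time \<zeta> (M \<omega>) (x i)}"
  have "AE \<omega> in P. \<forall>i\<in>{1..n}. sampled_mark_time (M \<omega>) (x i) = mark_time \<zeta> (M \<omega>) (x i)"
    using AE_sampled_mark_time_eq_fixed[OF xi] by (intro AE_finite_allI) auto
  then have "AE \<omega> in P. (\<Prod>i=1..n. if ennreal (q i) < sampled_mark_time (M \<omega>) (x i) then 1 else 0) =
      (indicator ?E \<omega> :: ennreal)"
    using AE_space
  proof eventually_elim
    case (elim \<omega>)
    then have "(\<Prod>i=1..n. if ennreal (q i) < sampled_mark_time (M \<omega>) (x i) then 1 else 0) =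
        (\<Prod>i=1..n. if ennreal (q i) < mark_time \<zeta> (M \<omega>) (x i) then 1 else (0::ennreal))"
      by (intro prod.cong) auto
    also have "\<dots> = indicator ?E \<omega>"
    proof (cases "\<omega> \<in> ?E")
      case True
      then show ?thesis by (simp add: prod.neutral)
    next
      case False
      then have "\<exists>i\<in>{1..n}. (if ennreal (q i) < mark_time \<zeta> (M \<omega>) (x i) then 1 else (0::ennreal)) = 0"
        using elim(2) by auto
      then have "(\<Prod>i=1..n. if ennreal (q i) < mark_time \<zeta> (M \<omega>) (x i) then 1 else (0::ennreal)) = 0"
        by (intro prod_zero) auto
      with False show ?thesis by (simp only: indicator_simps not_False_eq_True)
    qed
    finally show ?case .
  qed
  then have "(\<integral>\<^sup>+\<omega>. (\<Prod>i=1..n. if ennreal (q i) < sampled_mark_time (M \<omega>) (x i) then 1 else 0) \<partial>P) =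
      (\<integral>\<^sup>+\<omega>. indicator ?E \<omega> \<partial>P)"
    by (rule nn_integral_cong_AE)
  also have "\<dots> = emeasure P ?E"
    by (rule nn_integral_indicator) measurable
  also have "\<dots> = ennreal (exp (- (\<Sum>i=1..n. c * (spanned_length x i - spanned_length x (i - 1)) * q i)))"
    by (rule mark_time_survival_probability[OF x q])
  also have "\<dots> = (\<Prod>i=1..n. ennreal (exp (- (c * spanned_length x i - c * spanned_length x (i - 1)) * q i)))"
    by (subst prod_ennreal) (auto simp: exp_sum[symmetric] sum_negf[symmetric] algebra_simps intro!: arg_cong[where f = exp] sum.cong)
  finally show ?thesis .
qed


text \<open>The function \<open>g\<close> is the mass still attached to the root at a given time. The product of its values is
  expanded into an integral over \<open>r\<close>-tuples of points.\<close>
lemma total_mark_time_power: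
  assumes \<omega>: "\<omega> \<in> space P"
  shows "total_mark_time \<zeta> \<sigma> (M \<omega>) ^ r = fact r *
    (\<integral>\<^sup>+q. \<integral>\<^sup>+x. indicator (Collect (decreasing_above r 0)) q *
      (\<Prod>i=1..r. if ennreal (q i) < sampled_mark_time (M \<omega>) (x i) then 1 else 0)
      \<partial>PiM {1..r} (\<lambda>_. mass) \<partial>PiM {1..r} (\<lambda>_. lborel))"
proof -
  interpret mass_product: product_sigma_finite "\<lambda>_::nat. mass"
    by standard
  have [measurable]: "sampled_mark_time (M \<omega>) \<in> borel_measurable mass"
    using measurable_Pair2[OF sampled_mark_time_measurable \<omega>] by simp
  define g where "g u = (\<integral>\<^sup>+x. (if ennreal u < sampled_mark_time (M \<omega>) x then 1 else 0) \<partial>mass)" for u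
  have [measurable]: "g \<in> borel_measurable borel"
    unfolding g_def[abs_def] by measurable
  have "total_mark_time \<zeta> \<sigma> (M \<omega>) = (\<integral>\<^sup>+x. sampled_mark_time (M \<omega>) x \<partial>mass)"
    by (rule total_mark_time_eq[OF \<omega>])
  also have "\<dots> = (\<integral>\<^sup>+x. \<integral>\<^sup>+u. indicator {0<..} u * (if ennreal u < sampled_mark_time (M \<omega>) x then 1 else 0) \<partial>lborel \<partial>mass)"
    by (intro nn_integral_cong) (rule ennreal_eq_integral_below)
  also have "\<dots> = (\<integral>\<^sup>+u. \<integral>\<^sup>+x. indicator {0<..} u * (if ennreal u < sampled_mark_time (M \<omega>) x then 1 else 0) \<partial>mass \<partial>lborel)"
  proof -
    interpret pair_sigma_finite lborel mass ..
    show ?thesis by (rule Fubini') measurable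
  qed
  also have "\<dots> = (\<integral>\<^sup>+u. indicator {0<..} u * g u \<partial>lborel)"
    unfolding g_def by (intro nn_integral_cong nn_integral_cmult) measurable
  finally have "total_mark_time \<zeta> \<sigma> (M \<omega>) ^ r = fact r * simplex_integral r 0 (\<lambda>_. g)"
    by (simp only: power_eq_simplex_integral[OF \<open>g \<in> borel_measurable borel\<close>])
  also have "simplex_integral r 0 (\<lambda>_. g) =
      (\<integral>\<^sup>+q. \<integral>\<^sup>+x. indicator (Collect (decreasing_above r 0)) q *
      (\<Prod>i=1..r. if ennreal (q i) < sampled_mark_time (M \<omega>) (x i) then 1 else 0)
      \<partial>PiM {1..r} (\<lambda>_. mass) \<partial>PiM {1..r} (\<lambda>_. lborel))"
    unfolding simplex_integral_def
  proof (rule nn_integral_cong)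
    fix q :: "nat \<Rightarrow> real"
    have "(\<Prod>i=1..r. g (q i)) =
        (\<integral>\<^sup>+x. (\<Prod>i=1..r. if ennreal (q i) < sampled_mark_time (M \<omega>) (x i) then 1 else 0) \<partial>PiM {1..r} (\<lambda>_. mass))"
      unfolding g_def by (rule mass_product.product_nn_integral_prod[symmetric]) auto
    also have "indicator (Collect (decreasing_above r 0)) q * \<dots> =
        (\<integral>\<^sup>+x. indicator (Collect (decreasing_above r 0)) q *
          (\<Prod>i=1..r. if ennreal (q i) < sampled_mark_time (M \<omega>) (x i) then 1 else 0) \<partial>PiM {1..r} (\<lambda>_. mass))"
      by (rule nn_integral_cmult[symmetric]) measurable
    finally show "indicator (Collect (decreasing_above r 0)) q * (\<Prod>i=1..r. g (q i)) = \<dots>" .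
  qed
  finally show ?thesis .
qed

lemma total_mark_time_moment:
  "(\<integral>\<^sup>+\<omega>. total_mark_time \<zeta> \<sigma> (M \<omega>) ^ r \<partial>P) =
    fact r * (\<integral>\<^sup>+x. (\<Prod>i=1..r. 1 / ennreal (c * spanned_length x i)) \<partial>PiM {1..r} (\<lambda>_. mass))"
proof -
  interpret mass_product: finite_product_sigma_finite "\<lambda>_::nat. mass" "{1..r}"
    by standard auto
  interpret lborel_product: finite_product_sigma_finite "\<lambda>_::nat. lborel :: real measure" "{1..r}"
    by standard auto
  let ?m = "PiM {1..r} (\<lambda>_. mass)" and ?l = "PiM {1..r} (\<lambda>_. lborel :: real measure)"
  define F :: "'w \<Rightarrow> (nat \<Rightarrow> real) \<Rightarrow> (nat \<Rightarrow> real set) \<Rightarrow> ennreal" where "F \<omega> q x = indicator (Collect (decreasing_above r 0)) q *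
      (\<Prod>i=1..r. if ennreal (q i) < sampled_mark_time (M \<omega>) (x i) then 1 else 0)" for \<omega> q x
  have F_meas: "(\<lambda>(\<omega>, q, x). F \<omega> q x) \<in> borel_measurable (P \<Otimes>\<^sub>M ?l \<Otimes>\<^sub>M ?m)"
    unfolding F_def by measurable
  have [measurable (raw)]: "(\<lambda>y. F (f y) (g y) (h y)) \<in> borel_measurable N"
    if [measurable]: "f \<in> N \<rightarrow>\<^sub>M P" "g \<in> N \<rightarrow>\<^sub>M ?l" "h \<in> N \<rightarrow>\<^sub>M ?m" for N :: "'z measure" and f g h
  proof -
    have "(\<lambda>y. (f y, g y, h y)) \<in> N \<rightarrow>\<^sub>M P \<Otimes>\<^sub>M ?l \<Otimes>\<^sub>M ?m" by measurable
    from measurable_compose[OF this F_meas] show ?thesis by simp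
  qed
  have "(\<integral>\<^sup>+\<omega>. total_mark_time \<zeta> \<sigma> (M \<omega>) ^ r \<partial>P) =
      (\<integral>\<^sup>+\<omega>. fact r * (\<integral>\<^sup>+q. \<integral>\<^sup>+x. F \<omega> q x \<partial>?m \<partial>?l) \<partial>P)"
    unfolding F_def by (intro nn_integral_cong total_mark_time_power)
  also have "\<dots> = fact r * (\<integral>\<^sup>+\<omega>. \<integral>\<^sup>+q. \<integral>\<^sup>+x. F \<omega> q x \<partial>?m \<partial>?l \<partial>P)"
    by (rule nn_integral_cmult) measurable
  also have "(\<integral>\<^sup>+\<omega>. \<integral>\<^sup>+q. \<integral>\<^sup>+x. F \<omega> q x \<partial>?m \<partial>?l \<partial>P) =
      (\<integral>\<^sup>+q. \<integral>\<^sup>+\<omega>. \<integral>\<^sup>+x. F \<omega> q x \<partial>?m \<partial>P \<partial>?l)"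
  proof -
    interpret pair_sigma_finite ?l P ..
    show ?thesis by (rule Fubini') measurable
  qed
  also have "\<dots> = (\<integral>\<^sup>+q. \<integral>\<^sup>+x. \<integral>\<^sup>+\<omega>. F \<omega> q x \<partial>P \<partial>?m \<partial>?l)"
  proof -
    interpret pair_sigma_finite ?m P ..
    show ?thesis by (intro nn_integral_cong Fubini') measurable
  qed
  also have "\<dots> = (\<integral>\<^sup>+x. \<integral>\<^sup>+q. \<integral>\<^sup>+\<omega>. F \<omega> q x \<partial>P \<partial>?l \<partial>?m)"
  proof -
    interpret pair_sigma_finite ?m ?l ..
    show ?thesis by (rule Fubini') measurable
  qed
  also have "\<dots> = (\<integral>\<^sup>+x. (\<Prod>i=1..r. 1 / ennreal (c * spanned_length x i)) \<partial>?m)"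
  proof (rule nn_integral_cong)
    fix x assume x_space: "x \<in> space ?m"
    then have x: "x \<in> {1..r} \<rightarrow> tree \<zeta>" by (auto simp: space_PiM)
    have "(\<integral>\<^sup>+q. \<integral>\<^sup>+\<omega>. F \<omega> q x \<partial>P \<partial>?l) = simplex_integral r 0
        (\<lambda>i u. ennreal (exp (- (c * spanned_length x i - c * spanned_length x (i - 1)) * u)))"
      unfolding simplex_integral_def
    proof (rule nn_integral_cong)
      fix q
      show "(\<integral>\<^sup>+\<omega>. F \<omega> q x \<partial>P) = indicator (Collect (decreasing_above r 0)) q *
          (\<Prod>i=1..r. ennreal (exp (- (c * spanned_length x i - c * spanned_length x (i - 1)) * q i)))"
      proof (cases "decreasing_above r 0 q")
        case True
        then show ?thesis
          using sampled_mark_time_survival_probability[OF x True] by (simp add: F_def)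
      qed (simp add: F_def)
    qed
    also have "\<dots> = (\<Prod>i=1..r. 1 / ennreal (c * spanned_length x i))"
      using rate_pos by (subst simplex_integral_exp) (auto simp: spanned_length_def)
    finally show "(\<integral>\<^sup>+q. \<integral>\<^sup>+\<omega>. F \<omega> q x \<partial>P \<partial>?l) = (\<Prod>i=1..r. 1 / ennreal (c * spanned_length x i))" .
  qed
  finally show ?thesis .
qed

end

theorem theorem3p2:
  fixes \<zeta> :: "real \<Rightarrow> real" and \<sigma> \<alpha> :: real
    and L :: "real set measure"
    and P :: "'w measure" and M :: "'w \<Rightarrow> (real set \<times> real) measure"
    and r :: nat
  assumes "\<alpha> > 0"
    and "height_function \<zeta> \<sigma>"
    and "length_measure \<zeta> L"
    and "mark_process L \<alpha> P M"
    and "r \<ge> 1"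
  shows "(\<integral>\<^sup>+ \<omega>. total_mark_time \<zeta> \<sigma> (M \<omega>) ^ r \<partial>P) =
    ennreal (fact r / (2 * \<alpha>) ^ r) *
      (\<integral>\<^sup>+ x. 1 / (\<Prod>i=1..r. emeasure L (spanned_subtree \<zeta> x i))
         \<partial>PiM {1..r} (\<lambda>_. mass_measure \<zeta> \<sigma>))"
proof -
  interpret marked_tree \<zeta> \<sigma> L "2 * \<alpha>" P M
    using assms by unfold_locales (auto simp: mark_process_def mark_intensity_def)
  let ?m = "PiM {1..r} (\<lambda>_. mass)"
  have sub: "emeasure L (spanned_subtree \<zeta> x i) = emeasure L (spanned x i)"
    "emeasure L (spanned x i) = ennreal (spanned_length x i)"
    if "x \<in> space ?m" "i \<in> {1..r}" for x i
  proof -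
    have "x \<in> {1..i} \<rightarrow> tree \<zeta>" using that by (auto simp: space_PiM)
    then show "emeasure L (spanned_subtree \<zeta> x i) = emeasure L (spanned x i)"
      "emeasure L (spanned x i) = ennreal (spanned_length x i)"
      by (simp_all only: spanned_subtree_eq_spanned emeasure_spanned)
  qed
  have sets_m: "sets ?m = sets (PiM {1..r} (\<lambda>_. tree_borel \<zeta>))"
    by (intro sets_PiM_cong) (auto simp: sets_mass)
  have [measurable]: "(\<lambda>x. emeasure L (spanned x i)) \<in> borel_measurable ?m" if "i \<in> {1..r}" for i
    using emeasure_spanned_measurable[of i r] that by (simp add: measurable_cong_sets[OF sets_m refl])
  have "(\<integral>\<^sup>+\<omega>. total_mark_time \<zeta> \<sigma> (M \<omega>) ^ r \<partial>P) =
      fact r * (\<integral>\<^sup>+x. (\<Prod>i=1..r. 1 / ennreal (2 * \<alpha> * spanned_length x i)) \<partial>?m)"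
    by (rule total_mark_time_moment)
  also have "\<dots> = fact r * (\<integral>\<^sup>+x. ennreal (1 / (2 * \<alpha>) ^ r) * (1 / (\<Prod>i=1..r. emeasure L (spanned x i))) \<partial>?m)"
  proof (intro arg_cong2[where f = "(*)"] refl nn_integral_cong)
    fix x assume "x \<in> space ?m"
    then show "(\<Prod>i=1..r. 1 / ennreal (2 * \<alpha> * spanned_length x i)) =
        ennreal (1 / (2 * \<alpha>) ^ r) * (1 / (\<Prod>i=1..r. emeasure L (spanned x i)))"
      using assms(1) sub(2)
      by (subst ennreal_one_divide_prod) (auto simp: spanned_length_def[abs_def] simp del: One_nat_def
        intro!: arg_cong2[where f = "(*)"] arg_cong2[where f = "(/)"] prod.cong)
  qed
  also have "\<dots> = fact r * (ennreal (1 / (2 * \<alpha>) ^ r) * (\<integral>\<^sup>+x. 1 / (\<Prod>i=1..r. emeasure L (spanned x i)) \<partial>?m))"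
    by (subst nn_integral_cmult) measurable
  also have "\<dots> = (fact r * ennreal (1 / (2 * \<alpha>) ^ r)) * (\<integral>\<^sup>+x. 1 / (\<Prod>i=1..r. emeasure L (spanned x i)) \<partial>?m)"
    by (simp only: mult.assoc)
  also have "(fact r :: ennreal) * ennreal (1 / (2 * \<alpha>) ^ r) = ennreal (fact r / (2 * \<alpha>) ^ r)"
  proof -
    have "(fact r :: ennreal) = ennreal (fact r)"
      by (metis ennreal_of_nat_eq_real_of_nat of_nat_fact)
    then show ?thesis using assms(1) by (simp flip: ennreal_mult)
  qed
  also have "(\<integral>\<^sup>+x. 1 / (\<Prod>i=1..r. emeasure L (spanned x i)) \<partial>?m) =
      (\<integral>\<^sup>+x. 1 / (\<Prod>i=1..r. emeasure L (spanned_subtree \<zeta> x i)) \<partial>?m)"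
    using sub(1) by (intro nn_integral_cong arg_cong2[where f = "(/)"] prod.cong refl) auto
  finally show ?thesis .
qed

end
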